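(* Consider the multicolored multiple-drawing randomly reinforced urn described in the context. Assume: (A1) there is a constant $C_2$ such that $\sup_n \mathbb{E}(A_{nk}^3)<C_2$ for all $k\in\{1,\dots,d\}$; (A2) for all $k\in\{1,\dots,d\}$, $m_{nk}:=\mathbb{E}(A_{nk})\to m_k$ as $n\to\infty$, where $m_1,\dots,m_d$ are finite reals with $m_1=\dots=m_t>m_{t+1}\ge m_{t+2}\ge\dots\ge m_d$ for some $t\in\{1,\dots,d\}$; moreover $m_{n1}=m_{n2}=\dots=m_{nt}$ for all $n\ge 1$; (A3) for all $k,j\in\{1,\dots,d\}$, $\sum_{n=1}^\infty \frac{|m_{n+1,k}m_j-m_km_{n+1,j}|}{n}<\infty$; (N) $\mathbb E(N_{n+1}\mid\mathcal F_n)\to N$ almost surely, for some random variable $N$. Then for all $k\in\{1,\dots,d\}$ and $j\in\{1,\dots,d\}\setminus\{k\}$, there exists a random variable $\xi_{kj}$ taking values in $(0,\infty)$ such that $$\frac{H_{nk}}{H_{nj}^{m_k/m_j}}\to\xi_{kj}\quad\text{almost surely as } n\to\infty.$$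
   Context: Urn model. An urn contains balls of $d\ge 2$ colors. The initial composition is a deterministic vector $\mathbf H_0=(H_{01},\dots,H_{0d})^\top$ of positive integers. At each stage $n\ge1$, a random number $N_n$ of balls is drawn without replacement; $\mathbf X_n=(X_{n1},\dots,X_{nd})^\top$ records how many balls of each color are drawn, so $\sum_k X_{nk}=N_n$. The drawn balls are then returned together with $A_{nk}X_{nk}$ new balls of color $k$, for each $k$. Here $\mathbf R_n=\mathrm{diag}(A_{n1},\dots,A_{nd})$ is the random replacement matrix. So $H_{nk}=H_{0k}+\sum_{i=1}^n A_{ik}X_{ik}$, $S_n=\sum_{k=1}^d H_{nk}$. Let $\mathcal F_0$ be trivial, $\mathcal F_n=\sigma\{N_1,\mathbf X_1,\mathbf R_1,\dots,N_n,\mathbf X_n,\mathbf R_n\}$ and $\mathcal G_n=\sigma(\mathcal F_n,N_{n+1})$. Standing assumptions, for all $n\ge0$: (I) $N_{n+1}$ takes values in $\{1,2,\dots,\min(S_n,C_1)\}$ for some constant positive integer $C_1$. (II) Conditionally on $\mathcal G_n$, $\mathbf X_{n+1}$ is multivariate hypergeometric with parameters $(S_n,N_{n+1},\mathbf H_n)$: $\mathbb P(\mathbf X_{n+1}=\mathbf x\mid\mathcal G_n)=\prod_{k=1}^d\binom{H_{nk}}{x_k}\big/\binom{S_n}{N_{n+1}}$ for integer vectors $\mathbf x$ with $0\le x_k\le H_{nk}$ and $\sum_k x_k=N_{n+1}$. (III) Each $A_{n+1,k}$ takes (integer) values in $[1,\infty)$, and $\mathbf R_{n+1}$ is independent of $\sigma(\mathcal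 G_n,\mathbf X_{n+1})$. The components of $\mathbf R_{n+1}$ may be correlated with each other. *)

theory Defs
  imports "HOL-Probability.Probability"
begin

text \<open>Colours are the indices in \<open>{1..d}\<close>. Balls are counted by natural numbers:
  \<open>N n\<close> is the number of balls drawn at stage \<open>n \<ge> 1\<close>, \<open>X n k\<close> the number of drawn balls of
  colour \<open>k\<close>, and \<open>A n k\<close> the \<open>k\<close>-th diagonal entry of the replacement matrix \<open>R\<^sub>n\<close>. The values of
  \<open>N\<close>, \<open>X\<close>, \<open>A\<close> at stage \<open>0\<close> are never used.\<close>

definition urn_comp ::
  "(nat \<Rightarrow> nat) \<Rightarrow> (nat \<Rightarrow> nat \<Rightarrow> 'a \<Rightarrow> nat) \<Rightarrow> (nat \<Rightarrow> nat \<Rightarrow> 'a \<Rightarrow> nat) \<Rightarrow> nat \<Rightarrow> nat \<Rightarrow> 'a \<Rightarrow> nat"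
  where "urn_comp H0 X A n k \<omega> = H0 k + (\<Sum>i\<in>{1..n}. A i k \<omega> * X i k \<omega>)"

definition urn_total ::
  "nat \<Rightarrow> (nat \<Rightarrow> nat) \<Rightarrow> (nat \<Rightarrow> nat \<Rightarrow> 'a \<Rightarrow> nat) \<Rightarrow> (nat \<Rightarrow> nat \<Rightarrow> 'a \<Rightarrow> nat) \<Rightarrow> nat \<Rightarrow> 'a \<Rightarrow> nat"
  where "urn_total d H0 X A n \<omega> = (\<Sum>k\<in>{1..d}. urn_comp H0 X A n k \<omega>)"

text \<open>The \<open>\<sigma>\<close>-algebra on \<open>\<Omega>\<close> generated by a family of discrete random variables. It is not
  written as a supremum of measures because that has an empty space for the empty family.\<close>

definition sigma_of :: "'a set \<Rightarrow> ('a \<Rightarrow> nat) set \<Rightarrow> 'a measure"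
  where "sigma_of \<Omega> Ys = sigma \<Omega> {Y -` B \<inter> \<Omega> | Y B. Y \<in> Ys}"

definition urn_history ::
  "nat \<Rightarrow> (nat \<Rightarrow> 'a \<Rightarrow> nat) \<Rightarrow> (nat \<Rightarrow> nat \<Rightarrow> 'a \<Rightarrow> nat) \<Rightarrow> (nat \<Rightarrow> nat \<Rightarrow> 'a \<Rightarrow> nat) \<Rightarrow> nat \<Rightarrow> ('a \<Rightarrow> nat) set"
  where "urn_history d N X A n =
    {N i | i. i \<in> {1..n}} \<union> {X i k | i k. i \<in> {1..n} \<and> k \<in> {1..d}} \<union>
    {A i k | i k. i \<in> {1..n} \<and> k \<in> {1..d}}"

definition urn_F ::
  "'a measure \<Rightarrow> nat \<Rightarrow> (nat \<Rightarrow> 'a \<Rightarrow> nat) \<Rightarrow> (nat \<Rightarrow> nat \<Rightarrow> 'a \<Rightarrow> nat) \<Rightarrow> (nat \<Rightarrow> nat \<Rightarrow> 'a \<Rightarrow> nat) \<Rightarrow> nat \<Rightarrow> 'a measure"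
  where "urn_F M d N X A n = sigma_of (space M) (urn_history d N X A n)"

definition urn_G ::
  "'a measure \<Rightarrow> nat \<Rightarrow> (nat \<Rightarrow> 'a \<Rightarrow> nat) \<Rightarrow> (nat \<Rightarrow> nat \<Rightarrow> 'a \<Rightarrow> nat) \<Rightarrow> (nat \<Rightarrow> nat \<Rightarrow> 'a \<Rightarrow> nat) \<Rightarrow> nat \<Rightarrow> 'a measure"
  where "urn_G M d N X A n = sigma_of (space M) (urn_history d N X A n \<union> {N (Suc n)})"

text \<open>\<open>\<sigma>(G\<^sub>n, X\<^sub>n\<^sub>+\<^sub>1)\<close>, from which the replacement matrix \<open>R\<^sub>n\<^sub>+\<^sub>1\<close> is independent.\<close>

definition urn_GX ::
  "'a measure \<Rightarrow> nat \<Rightarrow> (nat \<Rightarrow> 'a \<Rightarrow> nat) \<Rightarrow> (nat \<Rightarrow> nat \<Rightarrow> 'a \<Rightarrow> nat) \<Rightarrow> (nat \<Rightarrow> nat \<Rightarrow> 'a \<Rightarrow> nat) \<Rightarrow> nat \<Rightarrow> 'a measure"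
  where "urn_GX M d N X A n = sigma_of (space M)
    (urn_history d N X A n \<union> {N (Suc n)} \<union> {X (Suc n) k | k. k \<in> {1..d}})"

definition urn_mean :: "'a measure \<Rightarrow> (nat \<Rightarrow> nat \<Rightarrow> 'a \<Rightarrow> nat) \<Rightarrow> nat \<Rightarrow> nat \<Rightarrow> real"
  where "urn_mean M A n k = (\<integral>\<omega>. real (A n k \<omega>) \<partial>M)"

text \<open>Probability mass at \<open>x\<close> of the number of balls of each colour in a sample of \<open>r\<close> balls
  drawn without replacement from an urn with \<open>h k\<close> balls of colour \<open>k\<close>.\<close>

definition mv_hypergeometric :: "nat \<Rightarrow> (nat \<Rightarrow> nat) \<Rightarrow> nat \<Rightarrow> (nat \<Rightarrow> nat) \<Rightarrow> real"
  where "mv_hypergeometric d h r x =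
    (if (\<forall>k\<in>{1..d}. x k \<le> h k) \<and> (\<Sum>k\<in>{1..d}. x k) = r
     then (\<Prod>k\<in>{1..d}. real (h k choose x k)) / real ((\<Sum>k\<in>{1..d}. h k) choose r)
     else 0)"

locale multidraw_urn = prob_space M
  for M :: "'a measure" +
  fixes d :: nat
    and H0 :: "nat \<Rightarrow> nat"
    and C1 :: nat
    and N :: "nat \<Rightarrow> 'a \<Rightarrow> nat"
    and X A :: "nat \<Rightarrow> nat \<Rightarrow> 'a \<Rightarrow> nat"
  assumes two_colours: "d \<ge> 2"
    and initial_pos: "\<And>k. k \<in> {1..d} \<Longrightarrow> H0 k > 0"
    and measurable_N: "\<And>n. n \<ge> 1 \<Longrightarrow> N n \<in> measurable M (count_space UNIV)"
    and measurable_X: "\<And>n k. n \<ge> 1 \<Longrightarrow> k \<in> {1..d} \<Longrightarrow> X n k \<in> measurable M (count_space UNIV)"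
    and measurable_A: "\<And>n k. n \<ge> 1 \<Longrightarrow> k \<in> {1..d} \<Longrightarrow> A n k \<in> measurable M (count_space UNIV)"
    and C1_pos: "C1 > 0"
    and draw_size: "\<And>n \<omega>. \<omega> \<in> space M \<Longrightarrow> N (Suc n) \<omega> \<in> {1..min (urn_total d H0 X A n \<omega>) C1}"
    and draw_law: "\<And>n x. AE \<omega> in M.
      real_cond_exp M (urn_G M d N X A n)
        (indicator {\<omega> \<in> space M. \<forall>k\<in>{1..d}. X (Suc n) k \<omega> = x k}) \<omega> =
      mv_hypergeometric d (\<lambda>k. urn_comp H0 X A n k \<omega>) (N (Suc n) \<omega>) x"
    and replacement_ge_1: "\<And>n k \<omega>. k \<in> {1..d} \<Longrightarrow> \<omega> \<in> space M \<Longrightarrow> A (Suc n) k \<omega> \<ge> 1"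
    and replacement_indep: "\<And>n. indep_set
      (sets (sigma_of (space M) {A (Suc n) k | k. k \<in> {1..d}}))
      (sets (urn_GX M d N X A n))"

end

theory Submission
  imports Defs
begin

text \<open>Write \<open>H\<^sub>n\<^sub>k\<close> for the number of balls of colour \<open>k\<close>, \<open>S\<^sub>n\<close> for the total number of balls
  and \<open>U\<^sub>n\<^sub>k = A\<^sub>n\<^sub>+\<^sub>1\<^sub>,\<^sub>k X\<^sub>n\<^sub>+\<^sub>1\<^sub>,\<^sub>k / H\<^sub>n\<^sub>k\<close> for the relative growth of colour \<open>k\<close> at stage \<open>n + 1\<close>, so that
  \<open>ln H\<^sub>n\<^sub>+\<^sub>1\<^sub>,\<^sub>k - ln H\<^sub>n\<^sub>k = ln (1 + U\<^sub>n\<^sub>k)\<close>. The conditional mean of \<open>U\<^sub>n\<^sub>k\<close> is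
  \<open>m\<^sub>n\<^sub>+\<^sub>1\<^sub>,\<^sub>k N\<^sub>n\<^sub>+\<^sub>1 / S\<^sub>n\<close> given the history and \<open>N\<^sub>n\<^sub>+\<^sub>1\<close>; the factor \<open>N\<^sub>n\<^sub>+\<^sub>1 / S\<^sub>n\<close> does not depend on the colour. Replacements
  are at least \<open>1\<close>, hence so is \<open>m\<^sub>k\<close>, and after taking logarithms and dividing by \<open>m\<^sub>k\<close> the claim is
  that \<open>ln H\<^sub>n\<^sub>k / m\<^sub>k - ln H\<^sub>n\<^sub>j / m\<^sub>j\<close> converges almost surely. The increments of this
  sequence are a martingale difference, a Taylor remainder of order \<open>U\<^sup>2\<close>, and the drift
  \<open>(m\<^sub>n\<^sub>+\<^sub>1\<^sub>,\<^sub>k / m\<^sub>k - m\<^sub>n\<^sub>+\<^sub>1\<^sub>,\<^sub>j / m\<^sub>j) N\<^sub>n\<^sub>+\<^sub>1 / S\<^sub>n\<close>. As \<open>S\<^sub>n \<ge> n\<close> and \<open>N\<^sub>n\<^sub>+\<^sub>1 \<le> C\<^sub>1\<close>, the drift is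
  summable by the hypothesis on the weighted series of the differences of the means.

  For the other two parts it suffices that \<open>E (U\<^sub>n\<^sub>k\<^sup>2)\<close> is summable. Since draws are bounded and
  replacements have bounded second moments, \<open>E (U\<^sub>n\<^sub>k\<^sup>2)\<close> is at most a constant times
  \<open>E (1 / (S\<^sub>n H\<^sub>n\<^sub>k))\<close> (lemma \<open>growth_second_moment\<close>). No growth rate of \<open>H\<^sub>n\<^sub>k\<close> is needed to sum
  this: \<open>1 / H\<^sub>n\<^sub>k\<close> is a bounded nonnegative supermartingale whose expected decrease at stage
  \<open>n + 1\<close> is at least a constant times \<open>E (1 / (S\<^sub>n H\<^sub>n\<^sub>k))\<close>, and these decreases telescope
  (lemma \<open>summable_inverse_total_balls\<close>). The martingale part then converges because its
  increments are orthogonal with summable second moments (lemma \<open>AE_summable_orthogonal\<close>, obtained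
  from Kolmogorov's maximal inequality), and the remainder is summable because \<open>\<Sum> U\<^sub>n\<^sub>k\<^sup>2\<close> has
  finite expectation.\<close>

section \<open>The mean of the multivariate hypergeometric distribution\<close>

lemma sum_PiE_insert:
  fixes f :: "('i \<Rightarrow> 'a) \<Rightarrow> 'b::comm_monoid_add"
  assumes "i \<notin> I"
  shows "(\<Sum>x\<in>Pi\<^sub>E (insert i I) B. f x) = (\<Sum>y\<in>B i. \<Sum>x\<in>Pi\<^sub>E I B. f (x(i := y)))"
proof -
  have "(\<Sum>x\<in>Pi\<^sub>E (insert i I) B. f x) = (\<Sum>p\<in>B i \<times> Pi\<^sub>E I B. f ((snd p)(i := fst p)))"
    unfolding PiE_insert_eq
    by (subst sum.reindex[OF inj_combinator[OF assms]]) (simp add: case_prod_beta)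
  also have "\<dots> = (\<Sum>y\<in>B i. \<Sum>x\<in>Pi\<^sub>E I B. f (x(i := y)))"
    by (simp add: sum.cartesian_product case_prod_beta)
  finally show ?thesis .
qed

text \<open>Vandermonde's identity with a summation range \<open>{..c}\<close> that may be larger than \<open>{..r}\<close>: sample
  vectors are later summed over a range that does not depend on the random sample size \<open>r\<close>.\<close>

lemma vandermonde_truncated:
  fixes a b r c :: nat
  assumes "r \<le> c"
  shows "(\<Sum>y\<le>c. if y \<le> r then (a choose y) * (b choose (r - y)) else 0) = (a + b) choose r"
proof -
  have "(\<Sum>y\<le>c. if y \<le> r then (a choose y) * (b choose (r - y)) else 0)
      = (\<Sum>y\<le>r. (a choose y) * (b choose (r - y)))"
    using assms by (intro sum.mono_neutral_cong_right) auto
  then show ?thesis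
    by (simp add: vandermonde)
qed

lemma vandermonde_multi:
  fixes h :: "'i \<Rightarrow> nat"
  assumes "finite I" "r \<le> c"
  shows "(\<Sum>x\<in>Pi\<^sub>E I (\<lambda>_. {..c}). if sum x I = r then (\<Prod>i\<in>I. h i choose x i) else 0)
       = (sum h I) choose r"
  using assms
proof (induction I arbitrary: r rule: finite_induct)
  case empty
  show ?case by (cases r) (auto simp: PiE_empty_domain)
next
  case (insert i I)
  have upd: "sum (x(i := y)) (insert i I) = y + sum x I"
    "(\<Prod>j\<in>insert i I. h j choose (x(i := y)) j) = (h i choose y) * (\<Prod>j\<in>I. h j choose x j)" for x y
    using insert.hyps by (auto intro!: arg_cong2[where f="(+)"] arg_cong2[where f="(*)"] sum.cong prod.cong)
  have "(\<Sum>x\<in>Pi\<^sub>E I (\<lambda>_. {..c}). if y + sum x I = r then (h i choose y) * (\<Prod>j\<in>I. h j choose x j) else 0)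
      = (if y \<le> r then (h i choose y) * (sum h I choose (r - y)) else 0)" for y
  proof (cases "y \<le> r")
    case True
    then have "(\<Sum>x\<in>Pi\<^sub>E I (\<lambda>_. {..c}). if y + sum x I = r then (h i choose y) * (\<Prod>j\<in>I. h j choose x j) else 0)
      = (h i choose y) * (\<Sum>x\<in>Pi\<^sub>E I (\<lambda>_. {..c}). if sum x I = r - y then (\<Prod>j\<in>I. h j choose x j) else 0)"
      unfolding sum_distrib_left by (intro sum.cong) auto
    then show ?thesis
      using insert.IH[of "r - y"] insert.prems True by simp
  qed (auto intro: sum.neutral)
  then show ?case
    unfolding sum_PiE_insert[OF insert.hyps(2)] upd
    using insert.hyps insert.prems by (simp add: vandermonde_truncated)
qed

text \<open>The mean number of balls of colour \<open>k\<close> in a sample of \<open>r\<close> balls, before division by the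
  number \<open>S choose r\<close> of samples.\<close>

lemma vandermonde_multi_weighted:
  fixes h :: "'i \<Rightarrow> nat"
  assumes I: "finite I" "k \<in> I" and r: "0 < r" "r \<le> c"
  shows "(\<Sum>x\<in>Pi\<^sub>E I (\<lambda>_. {..c}). if sum x I = r then x k * (\<Prod>i\<in>I. h i choose x i) else 0)
       = h k * ((sum h I - 1) choose (r - 1))"
proof -
  define J where "J = I - {k}"
  have J: "finite J" "k \<notin> J" "I = insert k J"
    using I by (auto simp: J_def)
  have upd: "sum (x(k := y)) I = y + sum x J" "(x(k := y)) k = y"
    "(\<Prod>j\<in>I. h j choose (x(k := y)) j) = (h k choose y) * (\<Prod>j\<in>J. h j choose x j)" for x y
    using J by (auto intro!: arg_cong2[where f="(+)"] arg_cong2[where f="(*)"] sum.cong prod.cong)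
  have "(\<Sum>x\<in>Pi\<^sub>E I (\<lambda>_. {..c}). if sum x I = r then x k * (\<Prod>i\<in>I. h i choose x i) else 0)
      = (\<Sum>y\<le>c. \<Sum>x\<in>Pi\<^sub>E J (\<lambda>_. {..c}).
          if y + sum x J = r then y * ((h k choose y) * (\<Prod>i\<in>J. h i choose x i)) else 0)"
    unfolding J(3) sum_PiE_insert[OF J(2)] upd[unfolded J(3)] ..
  also have "\<dots> = (\<Sum>y\<le>c. if y \<le> r then y * (h k choose y) * (sum h J choose (r - y)) else 0)"
  proof (rule sum.cong[OF refl])
    fix y
    show "(\<Sum>x\<in>Pi\<^sub>E J (\<lambda>_. {..c}).
          if y + sum x J = r then y * ((h k choose y) * (\<Prod>i\<in>J. h i choose x i)) else 0)
        = (if y \<le> r then y * (h k choose y) * (sum h J choose (r - y)) else 0)"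
    proof (cases "y \<le> r")
      case True
      then have "(\<Sum>x\<in>Pi\<^sub>E J (\<lambda>_. {..c}).
          if y + sum x J = r then y * ((h k choose y) * (\<Prod>i\<in>J. h i choose x i)) else 0)
        = (y * (h k choose y)) * (\<Sum>x\<in>Pi\<^sub>E J (\<lambda>_. {..c}). if sum x J = r - y then (\<Prod>j\<in>J. h j choose x j) else 0)"
        unfolding sum_distrib_left by (intro sum.cong) auto
      then show ?thesis
        using vandermonde_multi[OF J(1), of "r - y" c h] r True by simp
    qed (auto intro: sum.neutral)
  qed
  also have "\<dots> = (\<Sum>y\<le>r. y * (h k choose y) * (sum h J choose (r - y)))"
    using r by (intro sum.mono_neutral_cong_right) auto
  \<comment> \<open>Absorption: \<open>y * (h k choose y) = h k * ((h k - 1) choose (y - 1))\<close>, with \<open>y = Suc z\<close>.\<close>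
  also have "\<dots> = (\<Sum>z\<le>r - 1. h k * (((h k - 1) choose z) * (sum h J choose (r - 1 - z))))"
  proof -
    obtain q where q: "r = Suc q"
      using r by (cases r) auto
    show ?thesis
      unfolding q sum.atMost_Suc_shift
      using times_binomial_minus1_eq[of "Suc _" "h k"]
      by (simp add: mult.assoc[symmetric] del: binomial_Suc_Suc mult_Suc)
  qed
  also have "\<dots> = h k * ((h k - 1 + sum h J) choose (r - 1))"
    unfolding sum_distrib_left[symmetric] vandermonde ..
  also have "\<dots> = h k * ((sum h I - 1) choose (r - 1))"
    using J by (cases "h k = 0") auto
  finally show ?thesis .
qed

lemma mv_hypergeometric_mean:
  assumes k: "k \<in> {1..d}" and r: "0 < r" "r \<le> c" "r \<le> (\<Sum>i\<in>{1..d}. h i)"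
  shows "(\<Sum>x\<in>Pi\<^sub>E {1..d} (\<lambda>_. {..c}). real (x k) * mv_hypergeometric d h r x)
       = real r * real (h k) / real (\<Sum>i\<in>{1..d}. h i)"
proof -
  define S where "S = (\<Sum>i\<in>{1..d}. h i)"
  have pos: "0 < S choose r"
    using r by (simp add: S_def)
  have "real (x k) * mv_hypergeometric d h r x
      = real (if sum x {1..d} = r then x k * (\<Prod>i\<in>{1..d}. h i choose x i) else 0) / real (S choose r)" for x
  proof (cases "\<forall>i\<in>{1..d}. x i \<le> h i")
    case False
    then have "(\<Prod>i\<in>{1..d}. h i choose x i) = 0"
      by (intro prod_zero) (auto simp: not_le)
    with False show ?thesis
      unfolding mv_hypergeometric_def by simp
  qed (simp add: mv_hypergeometric_def S_def)
  then have "(\<Sum>x\<in>Pi\<^sub>E {1..d} (\<lambda>_. {..c}). real (x k) * mv_hypergeometric d h r x)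
      = real (\<Sum>x\<in>Pi\<^sub>E {1..d} (\<lambda>_. {..c}).
          if sum x {1..d} = r then x k * (\<Prod>i\<in>{1..d}. h i choose x i) else 0) / real (S choose r)"
    by (simp only: sum_divide_distrib[symmetric] of_nat_sum)
  also have "\<dots> = real (h k * ((S - 1) choose (r - 1))) / real (S choose r)"
    using k r by (subst vandermonde_multi_weighted) (auto simp: S_def)
  also have "\<dots> = real r * real (h k) / real S"
  proof -
    have "real r * real (S choose r) = real S * real ((S - 1) choose (r - 1))"
      using times_binomial_minus1_eq[OF r(1), of S] by (metis of_nat_mult)
    moreover have "0 < S"
      using r by (simp add: S_def)
    ultimately show ?thesis
      using pos by (simp add: field_simps)
  qed
  finally show ?thesis
    by (simp add: S_def)
qed

section \<open>Almost sure convergence of series of orthogonal increments\<close>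

lemma (in prob_space) integrable_of_square:
  fixes f :: "'a \<Rightarrow> real"
  assumes [measurable]: "f \<in> borel_measurable M" and "integrable M (\<lambda>\<omega>. (f \<omega>)\<^sup>2)"
  shows "integrable M f"
proof (rule Bochner_Integration.integrable_bound[of M "\<lambda>\<omega>. 1 + (f \<omega>)\<^sup>2"])
  have "\<bar>x\<bar> \<le> 1 + x\<^sup>2" for x :: real
    using zero_le_power2[of "\<bar>x\<bar> - 1"] zero_le_power2[of x] unfolding power2_diff by simp
  then show "AE \<omega> in M. norm (f \<omega>) \<le> norm (1 + (f \<omega>)\<^sup>2)"
    by (intro AE_I2) (metis real_norm_def abs_of_nonneg abs_ge_zero order_trans)
qed (use assms in auto)

lemma integrable_mult_of_squares:
  fixes f g :: "'a \<Rightarrow> real"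
  assumes [measurable]: "f \<in> borel_measurable M" "g \<in> borel_measurable M"
    and "integrable M (\<lambda>\<omega>. (f \<omega>)\<^sup>2)" "integrable M (\<lambda>\<omega>. (g \<omega>)\<^sup>2)"
  shows "integrable M (\<lambda>\<omega>. f \<omega> * g \<omega>)"
proof (rule Bochner_Integration.integrable_bound[of M "\<lambda>\<omega>. (f \<omega>)\<^sup>2 + (g \<omega>)\<^sup>2"])
  have "\<bar>x * y\<bar> \<le> x\<^sup>2 + y\<^sup>2" for x y :: real
    using zero_le_power2[of "\<bar>x\<bar> - \<bar>y\<bar>"] mult_nonneg_nonneg[OF abs_ge_zero abs_ge_zero, of x y]
    unfolding power2_diff abs_mult power2_abs by linarith
  then show "AE \<omega> in M. norm (f \<omega> * g \<omega>) \<le> norm ((f \<omega>)\<^sup>2 + (g \<omega>)\<^sup>2)"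
    by simp
qed (use assms in auto)

text \<open>Kolmogorov's maximal inequality. The sums are stopped at the first time they leave
  \<open>(-e, e)\<close>; the stopped sums \<open>Q\<close> have orthogonal increments and stay outside once the
  original sums have been outside, so Chebyshev's inequality for \<open>Q n\<close> gives the claim.\<close>

lemma (in prob_space) maximal_inequality_orthogonal:
  fixes D :: "nat \<Rightarrow> 'a \<Rightarrow> real" and F :: "nat \<Rightarrow> 'a measure"
  assumes sub: "\<And>n. subalgebra M (F n)"
    and mono: "\<And>n. subalgebra (F (Suc n)) (F n)"
    and adapted: "\<And>n. D n \<in> borel_measurable (F (Suc n))"
    and sq: "\<And>n. integrable M (\<lambda>\<omega>. (D n \<omega>)\<^sup>2)"
    and orth: "\<And>n g. g \<in> borel_measurable (F n) \<Longrightarrow> integrable M (\<lambda>\<omega>. (g \<omega>)\<^sup>2) \<Longrightarrow>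
      (\<integral>\<omega>. g \<omega> * D n \<omega> \<partial>M) = 0"
    and e: "0 < e"
  shows "prob {\<omega>\<in>space M. \<exists>i\<le>n. e \<le> \<bar>\<Sum>j<i. D j \<omega>\<bar>} \<le> (\<Sum>i<n. \<integral>\<omega>. (D i \<omega>)\<^sup>2 \<partial>M) / e\<^sup>2"
proof -
  define P where "P i \<omega> = (\<Sum>j<i. D j \<omega>)" for i \<omega>
  \<comment> \<open>\<open>T i\<close> indicates that the sums have not left \<open>(-e, e)\<close> up to time \<open>i\<close>.\<close>
  define T :: "nat \<Rightarrow> 'a \<Rightarrow> real" where "T i \<omega> = (if \<forall>j\<le>i. \<bar>P j \<omega>\<bar> < e then 1 else 0)" for i \<omega>
  define Q where "Q i \<omega> = (\<Sum>j<i. T j \<omega> * D j \<omega>)" for i \<omega>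
  have subF: "subalgebra (F j) (F i)" if "i \<le> j" for i j
    using that
  proof (induction j rule: dec_induct)
    case base
    show ?case by (simp add: subalgebra_def)
  next
    case (step j)
    then show ?case
      using mono[of j] by (auto simp: subalgebra_def)
  qed
  have D_meas: "D j \<in> borel_measurable (F i)" if "j < i" for i j
    using that by (intro measurable_from_subalg[OF subF adapted]) auto
  have P_meas: "P j \<in> borel_measurable (F i)" if "j \<le> i" for i j
    unfolding P_def using that by (intro borel_measurable_sum D_meas) auto
  have T_meas: "T j \<in> borel_measurable (F i)" if "j \<le> i" for i j
  proof -
    have [measurable]: "P l \<in> borel_measurable (F i)" if "l \<in> {..j}" for l
      using that \<open>j \<le> i\<close> by (intro P_meas) auto
    have "(\<lambda>\<omega>. if \<forall>l\<in>{..j}. \<bar>P l \<omega>\<bar> < e then 1 else 0 :: real) \<in> borel_measurable (F i)"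
      by measurable
    then show ?thesis
      by (simp add: T_def[abs_def] Ball_def)
  qed
  have Q_meas: "Q i \<in> borel_measurable (F i)" for i
    unfolding Q_def by (intro borel_measurable_sum borel_measurable_times D_meas T_meas) auto
  have [measurable]: "D i \<in> borel_measurable M" "P i \<in> borel_measurable M"
    "T i \<in> borel_measurable M" "Q i \<in> borel_measurable M" for i
    using measurable_from_subalg[OF sub] adapted P_meas T_meas Q_meas by blast+
  have T01: "T i \<omega> = 0 \<or> T i \<omega> = 1" for i \<omega>
    by (simp add: T_def)
  have Tsq: "(T i \<omega>)\<^sup>2 = T i \<omega>" for i \<omega>
    using T01[of i \<omega>] by auto
  have TD: "integrable M (\<lambda>\<omega>. T i \<omega> * (D i \<omega>)\<^sup>2)" for i
    by (rule Bochner_Integration.integrable_bound[OF sq[of i]])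
       (use T01 in \<open>auto simp: T_def\<close>)
  have QQ: "integrable M (\<lambda>\<omega>. (Q i \<omega>)\<^sup>2) \<and> (\<integral>\<omega>. (Q i \<omega>)\<^sup>2 \<partial>M) \<le> (\<Sum>j<i. \<integral>\<omega>. (D j \<omega>)\<^sup>2 \<partial>M)" for i
  proof (induction i)
    case 0
    show ?case by (simp add: Q_def)
  next
    case (Suc i)
    have split: "(Q (Suc i) \<omega>)\<^sup>2 = (Q i \<omega>)\<^sup>2 + 2 * (Q i \<omega> * T i \<omega> * D i \<omega>) + T i \<omega> * (D i \<omega>)\<^sup>2" for \<omega>
      using Tsq[of i \<omega>] by (simp add: Q_def power2_sum power_mult_distrib)
    have QT: "integrable M (\<lambda>\<omega>. (Q i \<omega> * T i \<omega>)\<^sup>2)"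
      by (rule Bochner_Integration.integrable_bound[of M "\<lambda>\<omega>. (Q i \<omega>)\<^sup>2"])
         (use Suc in \<open>auto simp: T_def\<close>)
    have int: "integrable M (\<lambda>\<omega>. Q i \<omega> * T i \<omega> * D i \<omega>)"
      by (rule integrable_mult_of_squares[OF _ _ QT sq]) auto
    have zero: "(\<integral>\<omega>. Q i \<omega> * T i \<omega> * D i \<omega> \<partial>M) = 0"
      by (rule orth[OF _ QT]) (intro borel_measurable_times Q_meas T_meas order_refl)
    have "(\<integral>\<omega>. T i \<omega> * (D i \<omega>)\<^sup>2 \<partial>M) \<le> (\<integral>\<omega>. (D i \<omega>)\<^sup>2 \<partial>M)"
      by (intro integral_mono TD sq) (auto simp: T_def)
    then show ?case
      unfolding split using Suc int zero TD[of i] by simp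
  qed
  have stop: "(T i \<omega> = 1 \<and> Q i \<omega> = P i \<omega>) \<or> (T i \<omega> = 0 \<and> e \<le> \<bar>Q i \<omega>\<bar>)" for i \<omega>
  proof (induction i)
    case 0
    show ?case using e by (simp add: T_def Q_def P_def)
  next
    case (Suc i)
    have T: "T (Suc i) \<omega> = (if T i \<omega> = 1 \<and> \<bar>P (Suc i) \<omega>\<bar> < e then 1 else 0)"
      by (auto simp: T_def le_Suc_eq)
    have "P (Suc i) \<omega> = P i \<omega> + D i \<omega>" "Q (Suc i) \<omega> = Q i \<omega> + T i \<omega> * D i \<omega>"
      by (auto simp: P_def Q_def)
    then show ?case
      using Suc T by auto
  qed
  have "{\<omega>\<in>space M. \<exists>i\<le>n. e \<le> \<bar>\<Sum>j<i. D j \<omega>\<bar>} \<subseteq> {\<omega>\<in>space M. e\<^sup>2 \<le> (Q n \<omega>)\<^sup>2}"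
  proof safe
    fix \<omega> i assume "i \<le> n" "e \<le> \<bar>\<Sum>j<i. D j \<omega>\<bar>"
    then have "T n \<omega> = 0"
      by (auto simp: T_def P_def not_less)
    then have "e \<le> \<bar>Q n \<omega>\<bar>"
      using stop[of n \<omega>] by auto
    then show "e\<^sup>2 \<le> (Q n \<omega>)\<^sup>2"
      using e by (metis power_mono power2_abs less_imp_le)
  qed
  then have "prob {\<omega>\<in>space M. \<exists>i\<le>n. e \<le> \<bar>\<Sum>j<i. D j \<omega>\<bar>} \<le> prob {\<omega>\<in>space M. e\<^sup>2 \<le> (Q n \<omega>)\<^sup>2}"
    by (intro finite_measure_mono) auto
  also have "\<dots> \<le> (\<integral>\<omega>. (Q n \<omega>)\<^sup>2 \<partial>M) / e\<^sup>2"
    by (rule integral_Markov_inequality_measure[where A="space M"]) (use QQ e in auto)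
  also have "\<dots> \<le> (\<Sum>i<n. \<integral>\<omega>. (D i \<omega>)\<^sup>2 \<partial>M) / e\<^sup>2"
    using QQ e by (intro divide_right_mono) auto
  finally show ?thesis .
qed

text \<open>The orthogonality hypothesis says that \<open>D\<close> is a square-integrable martingale difference
  sequence for the filtration \<open>F\<close>; tested against square-integrable \<open>g\<close>, it needs no
  conditional expectations.\<close>

lemma (in prob_space) AE_summable_orthogonal:
  fixes D :: "nat \<Rightarrow> 'a \<Rightarrow> real" and F :: "nat \<Rightarrow> 'a measure"
  assumes sub: "\<And>n. subalgebra M (F n)"
    and mono: "\<And>n. subalgebra (F (Suc n)) (F n)"
    and adapted: "\<And>n. D n \<in> borel_measurable (F (Suc n))"
    and sq: "\<And>n. integrable M (\<lambda>\<omega>. (D n \<omega>)\<^sup>2)"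
    and orth: "\<And>n g. g \<in> borel_measurable (F n) \<Longrightarrow> integrable M (\<lambda>\<omega>. (g \<omega>)\<^sup>2) \<Longrightarrow>
      (\<integral>\<omega>. g \<omega> * D n \<omega> \<partial>M) = 0"
    and summ: "summable (\<lambda>n. \<integral>\<omega>. (D n \<omega>)\<^sup>2 \<partial>M)"
  shows "AE \<omega> in M. summable (\<lambda>n. D n \<omega>)"
proof -
  define v where "v n = (\<integral>\<omega>. (D n \<omega>)\<^sup>2 \<partial>M)" for n
  have v0: "0 \<le> v n" for n
    by (simp add: v_def)
  have [measurable]: "D i \<in> borel_measurable M" for i
    using measurable_from_subalg[OF sub adapted] .
  define B where "B e m = {\<omega>\<in>space M. \<exists>i. e \<le> \<bar>\<Sum>j<i. D (m + j) \<omega>\<bar>}" for e :: real and m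
  have [measurable]: "B e m \<in> sets M" for e m
    unfolding B_def by measurable
  have B_le: "prob (B e m) \<le> (\<Sum>i. v (i + m)) / e\<^sup>2" if "0 < e" for e m
  proof (rule LIMSEQ_le_const2)
    let ?A = "\<lambda>n. {\<omega>\<in>space M. \<exists>i\<le>n. e \<le> \<bar>\<Sum>j<i. D (m + j) \<omega>\<bar>}"
    have "(\<lambda>n. prob (?A n)) \<longlonglongrightarrow> prob (\<Union>n. ?A n)"
      by (rule finite_Lim_measure_incseq) (auto intro!: incseq_SucI intro: le_SucI)
    moreover have "(\<Union>n. ?A n) = B e m"
      by (auto simp: B_def)
    ultimately show "(\<lambda>n. prob (?A n)) \<longlonglongrightarrow> prob (B e m)"
      by simp
    have "prob (?A n) \<le> (\<Sum>i. v (i + m)) / e\<^sup>2" for n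
    proof -
      have "prob (?A n) \<le> (\<Sum>i<n. v (m + i)) / e\<^sup>2"
        unfolding v_def
        by (rule maximal_inequality_orthogonal[where F="\<lambda>n. F (m + n)"])
           (use sub mono adapted sq orth that in auto)
      also have "(\<Sum>i<n. v (m + i)) \<le> (\<Sum>i. v (i + m))"
        using sum_le_suminf[of "\<lambda>i. v (i + m)" "{..<n}"] summ v0
        by (simp add: add.commute v_def[symmetric] summable_iff_shift)
      finally show ?thesis
        using that by (simp add: divide_right_mono)
    qed
    then show "\<exists>N. \<forall>n\<ge>N. prob (?A n) \<le> (\<Sum>i. v (i + m)) / e\<^sup>2"
      by blast
  qed
  have null: "AE \<omega> in M. \<exists>m. \<omega> \<notin> B e m" if "0 < e" for e
  proof -
    have "prob (\<Inter>m. B e m) \<le> 0"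
    proof (rule LIMSEQ_le_const)
      show "(\<lambda>m. (\<Sum>i. v (i + m)) / e\<^sup>2) \<longlonglongrightarrow> 0"
        using tendsto_divide_zero[OF suminf_exist_split2[OF summ]] by (simp add: v_def)
      have "prob (\<Inter>m. B e m) \<le> prob (B e m)" for m
        by (intro finite_measure_mono) auto
      then show "\<exists>N. \<forall>n\<ge>N. prob (\<Inter>m. B e m) \<le> (\<Sum>i. v (i + n)) / e\<^sup>2"
        using B_le[OF that] order_trans by blast
    qed
    then have "prob (\<Inter>m. B e m) = 0"
      by (simp add: measure_le_0_iff)
    then have "(\<Inter>m. B e m) \<in> null_sets M"
      by (intro null_setsI) (auto simp: emeasure_eq_measure)
    then show ?thesis
      by (rule AE_I') auto
  qed
  have "AE \<omega> in M. \<forall>q. \<exists>m. \<omega> \<notin> B (inverse (real (Suc q))) m"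
    unfolding AE_all_countable by (intro allI null) simp
  then show ?thesis
    using AE_space
  proof eventually_elim
    case *: (elim \<omega>)
    show "summable (\<lambda>n. D n \<omega>)"
      unfolding summable_Cauchy
    proof (intro allI impI)
      fix e :: real assume "0 < e"
      then obtain q where q: "inverse (real (Suc q)) < e / 2"
        using reals_Archimedean[of "e/2"] by auto
      from * obtain m where "\<omega> \<notin> B (inverse (real (Suc q))) m"
        by blast
      with *(2) have small: "\<bar>\<Sum>j<i. D (m + j) \<omega>\<bar> < e / 2" for i
        using q unfolding B_def mem_Collect_eq not_ex not_le de_Morgan_conj by (metis order.strict_trans)
      have sum_eq: "(\<Sum>j<i. D (m + j) \<omega>) = (\<Sum>j=m..<m+i. D j \<omega>)" for i
        using sum.shift_bounds_nat_ivl[of "\<lambda>j. D j \<omega>" 0 m i] by (simp add: lessThan_atLeast0 add.commute)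
      have "\<bar>\<Sum>j=a..<b. D j \<omega>\<bar> < e" if "m \<le> a" for a b
      proof (cases "a \<le> b")
        case True
        have "(\<Sum>j=m..<a. D j \<omega>) + (\<Sum>j=a..<b. D j \<omega>) = (\<Sum>j=m..<b. D j \<omega>)"
          using that True by (intro sum.atLeastLessThan_concat) auto
        then show ?thesis
          using small[of "a - m"] small[of "b - m"] that True unfolding sum_eq by simp
      qed (use \<open>0 < e\<close> in simp)
      then show "\<exists>N. \<forall>a\<ge>N. \<forall>b. norm (sum (\<lambda>n. D n \<omega>) {a..<b}) < e"
        by (auto intro!: exI[of _ m])
    qed
  qed
qed

lemma AE_summable_of_summable_integral:
  fixes f :: "nat \<Rightarrow> 'a \<Rightarrow> real"
  assumes int: "\<And>n. integrable M (f n)" and nonneg: "\<And>n \<omega>. 0 \<le> f n \<omega>"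
    and summ: "summable (\<lambda>n. \<integral>\<omega>. f n \<omega> \<partial>M)"
  shows "AE \<omega> in M. summable (\<lambda>n. f n \<omega>)"
proof -
  have [measurable]: "f n \<in> borel_measurable M" for n
    using int[of n] by simp
  have "(\<integral>\<^sup>+\<omega>. (\<Sum>n. ennreal (f n \<omega>)) \<partial>M) = (\<Sum>n. \<integral>\<^sup>+\<omega>. ennreal (f n \<omega>) \<partial>M)"
    by (rule nn_integral_suminf) measurable
  also have "\<dots> = (\<Sum>n. ennreal (\<integral>\<omega>. f n \<omega> \<partial>M))"
    using int nonneg by (intro suminf_cong nn_integral_eq_integral) auto
  also have "\<dots> \<noteq> \<infinity>"
    using summ nonneg by (simp add: suminf_ennreal_eq[OF _ summable_sums[OF summ]])
  finally have "AE \<omega> in M. (\<Sum>n. ennreal (f n \<omega>)) \<noteq> \<infinity>"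
    by (intro nn_integral_PInf_AE) auto
  then show ?thesis
    by eventually_elim (auto intro: summable_suminf_not_top nonneg)
qed

lemma (in prob_space) AE_bounded_integrable:
  fixes f :: "'a \<Rightarrow> real"
  assumes "f \<in> borel_measurable M" "AE \<omega> in M. \<bar>f \<omega>\<bar> \<le> B"
  shows "integrable M f"
  using assms by (intro integrable_const_bound[where B=B]) auto

lemma ln_one_plus_bound:
  fixes x :: real
  assumes "0 \<le> x"
  shows "\<bar>ln (1 + x) - x\<bar> \<le> x\<^sup>2"
proof (cases "x \<le> 1")
  case True
  then show ?thesis
    using assms by (rule abs_ln_one_plus_x_minus_x_bound_nonneg[rotated])
next
  case False
  then have "x \<le> x\<^sup>2"
    by (simp add: power2_eq_square)
  moreover have "0 \<le> ln (1 + x)" "ln (1 + x) \<le> x"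
    using assms by (auto intro: ln_add_one_self_le_self)
  ultimately show ?thesis
    by simp
qed

section \<open>The filtration of the urn\<close>

lemma space_sigma_of [simp]: "space (sigma_of \<Omega> Ys) = \<Omega>"
  and sets_sigma_of: "sets (sigma_of \<Omega> Ys) = sigma_sets \<Omega> {Y -` B \<inter> \<Omega> | Y B. Y \<in> Ys}"
  unfolding sigma_of_def by (intro space_measure_of sets_measure_of; auto)+

lemma measurable_sigma_of: "Y \<in> Ys \<Longrightarrow> Y \<in> measurable (sigma_of \<Omega> Ys) (count_space UNIV)"
  by (rule measurableI) (auto simp: sets_sigma_of)

lemma subalgebra_sigma_of_mono:
  "Ys \<subseteq> Zs \<Longrightarrow> subalgebra (sigma_of \<Omega> Zs) (sigma_of \<Omega> Ys)"
  unfolding subalgebra_def sets_sigma_of by (auto intro!: sigma_sets_mono')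

lemma subalgebra_sigma_of:
  assumes "\<And>Y. Y \<in> Ys \<Longrightarrow> Y \<in> measurable M (count_space UNIV)"
  shows "subalgebra M (sigma_of (space M) Ys)"
  unfolding subalgebra_def sets_sigma_of
  by (auto intro!: sets.sigma_sets_subset measurable_sets[OF assms])

lemma measurable_real_of_nat:
  "Y \<in> measurable M (count_space UNIV) \<Longrightarrow> (\<lambda>\<omega>. real (Y \<omega>)) \<in> borel_measurable M"
  by (rule measurable_compose) auto

context multidraw_urn
begin

text \<open>The \<open>\<sigma>\<close>-algebras generated by the history up to stage \<open>n\<close>, by the history and the next sample
  size, and by the history, the next sample size and the next sample.\<close>

abbreviation \<F> where "\<F> n \<equiv> urn_F M d N X A n"
abbreviation \<G> where "\<G> n \<equiv> urn_G M d N X A n"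
abbreviation \<H> where "\<H> n \<equiv> urn_GX M d N X A n"

text \<open>The number of balls of colour \<open>k\<close>, and the number of all balls, after stage \<open>n\<close>, as reals.\<close>

definition balls :: "nat \<Rightarrow> nat \<Rightarrow> 'a \<Rightarrow> real"
  where "balls n k \<omega> = real (urn_comp H0 X A n k \<omega>)"

definition total_balls :: "nat \<Rightarrow> 'a \<Rightarrow> real"
  where "total_balls n \<omega> = real (urn_total d H0 X A n \<omega>)"

text \<open>The number of balls of colour \<open>k\<close> added at stage \<open>n + 1\<close>, relative to the number present.\<close>

definition growth :: "nat \<Rightarrow> nat \<Rightarrow> 'a \<Rightarrow> real"
  where "growth n k \<omega> = real (A (Suc n) k \<omega>) * real (X (Suc n) k \<omega>) / balls n k \<omega>"

lemma urn_history_Suc: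
  "urn_history d N X A (Suc n) = urn_history d N X A n \<union> {N (Suc n)} \<union>
    {X (Suc n) k | k. k \<in> {1..d}} \<union> {A (Suc n) k | k. k \<in> {1..d}}"
proof -
  have *: "i \<in> {1..Suc n} \<longleftrightarrow> i \<in> {1..n} \<or> i = Suc n" for i
    by auto
  show ?thesis
    unfolding urn_history_def * by blast
qed

lemma history_mem:
  shows "i \<in> {1..n} \<Longrightarrow> N i \<in> urn_history d N X A n"
    and "i \<in> {1..n} \<Longrightarrow> k \<in> {1..d} \<Longrightarrow> X i k \<in> urn_history d N X A n"
    and "i \<in> {1..n} \<Longrightarrow> k \<in> {1..d} \<Longrightarrow> A i k \<in> urn_history d N X A n"
  unfolding urn_history_def by blast+

lemma subalgebra_G_F: "subalgebra (\<G> n) (\<F> n)"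
  unfolding urn_G_def urn_F_def by (rule subalgebra_sigma_of_mono) blast

lemma subalgebra_GX_G: "subalgebra (\<H> n) (\<G> n)"
  unfolding urn_G_def urn_GX_def by (rule subalgebra_sigma_of_mono) blast

lemma subalgebra_F_GX: "subalgebra (\<F> (Suc n)) (\<H> n)"
  unfolding urn_F_def urn_GX_def urn_history_Suc by (rule subalgebra_sigma_of_mono) blast

lemma subalgebra_F_Suc: "subalgebra (\<F> (Suc n)) (\<F> n)"
  unfolding urn_F_def urn_history_Suc by (rule subalgebra_sigma_of_mono) blast

lemma subalgebra_M_F: "subalgebra M (\<F> n)"
  unfolding urn_F_def
  by (rule subalgebra_sigma_of)
     (auto simp: urn_history_def intro: measurable_N measurable_X measurable_A)

lemma subalgebra_M_GX: "subalgebra M (\<H> n)"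
  using subalgebra_M_F[of "Suc n"] subalgebra_F_GX[of n] by (auto simp: subalgebra_def)

lemma subalgebra_M_G: "subalgebra M (\<G> n)"
  using subalgebra_M_GX[of n] subalgebra_GX_G[of n] by (auto simp: subalgebra_def)

lemma measurable_G_M: "f \<in> borel_measurable (\<G> n) \<Longrightarrow> f \<in> borel_measurable M"
  by (rule measurable_from_subalg[OF subalgebra_M_G])

lemma measurable_GX_M: "f \<in> borel_measurable (\<H> n) \<Longrightarrow> f \<in> borel_measurable M"
  by (rule measurable_from_subalg[OF subalgebra_M_GX])

lemma measurable_F_G: "f \<in> borel_measurable (\<F> n) \<Longrightarrow> f \<in> borel_measurable (\<G> n)"
  by (rule measurable_from_subalg[OF subalgebra_G_F])

lemma measurable_G_GX: "f \<in> borel_measurable (\<G> n) \<Longrightarrow> f \<in> borel_measurable (\<H> n)"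
  by (rule measurable_from_subalg[OF subalgebra_GX_G])

lemma measurable_GX_F: "f \<in> borel_measurable (\<H> n) \<Longrightarrow> f \<in> borel_measurable (\<F> (Suc n))"
  by (rule measurable_from_subalg[OF subalgebra_F_GX])

lemma balls_measurable_F: "k \<in> {1..d} \<Longrightarrow> balls n k \<in> borel_measurable (\<F> n)"
  unfolding balls_def[abs_def] urn_comp_def of_nat_add of_nat_sum of_nat_mult urn_F_def
  by (intro borel_measurable_add borel_measurable_const borel_measurable_sum borel_measurable_times
        measurable_real_of_nat measurable_sigma_of history_mem)

lemma total_balls_eq_sum: "total_balls n \<omega> = (\<Sum>k\<in>{1..d}. balls n k \<omega>)"
  by (simp add: total_balls_def balls_def urn_total_def)

lemma total_balls_measurable_F: "total_balls n \<in> borel_measurable (\<F> n)"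
  unfolding total_balls_eq_sum[abs_def] by (intro borel_measurable_sum balls_measurable_F)

lemma N_measurable_G: "(\<lambda>\<omega>. real (N (Suc n) \<omega>)) \<in> borel_measurable (\<G> n)"
  unfolding urn_G_def by (intro measurable_real_of_nat measurable_sigma_of) auto

lemma X_measurable_GX:
  "k \<in> {1..d} \<Longrightarrow> (\<lambda>\<omega>. real (X (Suc n) k \<omega>)) \<in> borel_measurable (\<H> n)"
  unfolding urn_GX_def by (intro measurable_real_of_nat measurable_sigma_of) auto

lemma A_measurable_F:
  "k \<in> {1..d} \<Longrightarrow> (\<lambda>\<omega>. real (A (Suc n) k \<omega>)) \<in> borel_measurable (\<F> (Suc n))"
  unfolding urn_F_def by (intro measurable_real_of_nat measurable_sigma_of history_mem) auto

lemma measurable_M [measurable]: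
  shows "k \<in> {1..d} \<Longrightarrow> balls n k \<in> borel_measurable M"
    and "total_balls n \<in> borel_measurable M"
    and "(\<lambda>\<omega>. real (N (Suc n) \<omega>)) \<in> borel_measurable M"
    and "k \<in> {1..d} \<Longrightarrow> (\<lambda>\<omega>. real (X (Suc n) k \<omega>)) \<in> borel_measurable M"
    and "k \<in> {1..d} \<Longrightarrow> (\<lambda>\<omega>. real (A (Suc n) k \<omega>)) \<in> borel_measurable M"
  using balls_measurable_F total_balls_measurable_F N_measurable_G X_measurable_GX A_measurable_F
    measurable_G_M measurable_GX_M measurable_F_G measurable_from_subalg[OF subalgebra_M_F] by blast+

lemma balls_ge_1: "k \<in> {1..d} \<Longrightarrow> 1 \<le> balls n k \<omega>"
  using initial_pos[of k] unfolding balls_def real_of_nat_ge_one_iff urn_comp_def by simp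

lemma balls_le_total: "k \<in> {1..d} \<Longrightarrow> balls n k \<omega> \<le> total_balls n \<omega>"
  unfolding total_balls_eq_sum by (rule member_le_sum) (auto simp: balls_def)

lemma total_balls_ge_1: "1 \<le> total_balls n \<omega>"
  using balls_ge_1[of 1] balls_le_total[of 1] two_colours order_trans by fastforce

lemma N_bounds:
  assumes "\<omega> \<in> space M"
  shows "1 \<le> N (Suc n) \<omega>" "N (Suc n) \<omega> \<le> C1" "N (Suc n) \<omega> \<le> urn_total d H0 X A n \<omega>"
  using draw_size[OF assms, of n] by auto

lemma balls_Suc:
  assumes "k \<in> {1..d}"
  shows "balls (Suc n) k \<omega> = balls n k \<omega> + real (A (Suc n) k \<omega>) * real (X (Suc n) k \<omega>)"
    and "balls (Suc n) k \<omega> = balls n k \<omega> * (1 + growth n k \<omega>)"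
proof -
  show *: "balls (Suc n) k \<omega> = balls n k \<omega> + real (A (Suc n) k \<omega>) * real (X (Suc n) k \<omega>)"
    by (simp add: balls_def urn_comp_def)
  show "balls (Suc n) k \<omega> = balls n k \<omega> * (1 + growth n k \<omega>)"
    using balls_ge_1[OF assms, of n \<omega>] unfolding * growth_def by (simp add: field_simps)
qed

section \<open>Draws and replacements\<close>

text \<open>That a sample of size \<open>N (Suc n)\<close> has this many balls is only encoded in its conditional law:
  sample vectors \<open>x\<close> with another sum have mass zero, and there are countably many of them.\<close>

lemma sum_draws_eq: "AE \<omega> in M. (\<Sum>k\<in>{1..d}. X (Suc n) k \<omega>) = N (Suc n) \<omega>"
proof -
  interpret G: finite_measure_subalgebra M "\<G> n"
    by unfold_locales (rule subalgebra_M_G)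
  have "AE \<omega> in M. \<forall>x\<in>Pi\<^sub>E {1..d} (\<lambda>_. UNIV). \<not> ((\<forall>k\<in>{1..d}. X (Suc n) k \<omega> = x k) \<and> N (Suc n) \<omega> \<noteq> sum x {1..d})"
  proof (rule AE_ball_countable')
    show "countable (Pi\<^sub>E {1..d} (\<lambda>_. UNIV :: nat set))"
      by (intro countable_PiE) auto
    fix x :: "nat \<Rightarrow> nat"
    define E where "E = {\<omega> \<in> space M. \<forall>k\<in>{1..d}. X (Suc n) k \<omega> = x k}"
    define B where "B = {\<omega> \<in> space M. N (Suc n) \<omega> \<noteq> sum x {1..d}}"
    have [measurable]: "X (Suc n) k \<in> measurable M (count_space UNIV)" if "k \<in> {1..d}" for k
      using that by (intro measurable_X) auto
    have E: "E \<in> sets M"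
      unfolding E_def by measurable
    have "{\<omega> \<in> space (\<G> n). real (N (Suc n) \<omega>) \<noteq> real (sum x {1..d})} \<in> sets (\<G> n)"
      using N_measurable_G[of n] by measurable
    then have B: "B \<in> sets (\<G> n)"
      by (simp only: B_def of_nat_eq_iff) (simp add: urn_G_def)
    have BM: "B \<in> sets M"
      using B subalgebra_M_G[of n] by (auto simp: subalgebra_def)
    have "prob (B \<inter> E) = (\<integral>\<omega>. indicator B \<omega> * indicator E \<omega> \<partial>M)"
      using E BM by (simp add: indicator_inter_arith[symmetric])
    also have "\<dots> = (\<integral>\<omega>. indicator B \<omega> * real_cond_exp M (\<G> n) (indicator E) \<omega> \<partial>M)"
      by (rule G.real_cond_exp_intg(2)[symmetric])
         (use E B BM in \<open>auto simp: indicator_inter_arith[symmetric] less_top[symmetric]\<close>)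
    also have "\<dots> = (\<integral>\<omega>. 0 \<partial>M)"
    proof (rule integral_cong_AE)
      show "AE \<omega> in M. indicator B \<omega> * real_cond_exp M (\<G> n) (indicator E) \<omega> = 0"
        using draw_law[of n x] unfolding E_def[symmetric]
        by eventually_elim (auto simp: mv_hypergeometric_def B_def)
    qed (use BM in auto)
    finally have "B \<inter> E \<in> null_sets M"
      using E BM by (intro null_setsI) (auto simp: emeasure_eq_measure)
    then show "AE \<omega> in M. \<not> ((\<forall>k\<in>{1..d}. X (Suc n) k \<omega> = x k) \<and> N (Suc n) \<omega> \<noteq> sum x {1..d})"
      by (rule AE_I') (auto simp: E_def B_def)
  qed
  then show ?thesis
  proof eventually_elim
    case (elim \<omega>)
    from elim[rule_format, of "restrict (\<lambda>k. X (Suc n) k \<omega>) {1..d}"] show ?case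
      by auto
  qed
qed

lemma draws_le: "AE \<omega> in M. \<forall>k\<in>{1..d}. X (Suc n) k \<omega> \<le> C1"
  using sum_draws_eq[of n] AE_space
proof eventually_elim
  case (elim \<omega>)
  have "X (Suc n) k \<omega> \<le> (\<Sum>k\<in>{1..d}. X (Suc n) k \<omega>)" if "k \<in> {1..d}" for k
    using that by (intro member_le_sum) auto
  then show ?case
    using elim N_bounds(2)[of \<omega> n] by fastforce
qed

lemma total_balls_ge: "AE \<omega> in M. \<forall>n. real n \<le> total_balls n \<omega>"
proof -
  have "AE \<omega> in M. \<forall>n. (\<Sum>k\<in>{1..d}. X (Suc n) k \<omega>) = N (Suc n) \<omega>"
    unfolding AE_all_countable by (intro allI sum_draws_eq)
  then show ?thesis
    using AE_space
  proof eventually_elim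
    case (elim \<omega>)
    have "n \<le> urn_total d H0 X A n \<omega>" for n
    proof (induction n)
      case (Suc n)
      have "urn_total d H0 X A (Suc n) \<omega>
          = urn_total d H0 X A n \<omega> + (\<Sum>k\<in>{1..d}. A (Suc n) k \<omega> * X (Suc n) k \<omega>)"
        by (simp add: urn_total_def urn_comp_def sum.distrib)
      moreover have "(\<Sum>k\<in>{1..d}. X (Suc n) k \<omega>) \<le> (\<Sum>k\<in>{1..d}. A (Suc n) k \<omega> * X (Suc n) k \<omega>)"
        using replacement_ge_1[OF _ elim(2), of _ n] by (intro sum_mono) auto
      ultimately show ?case
        using Suc elim(1)[rule_format, of n] N_bounds(1)[OF elim(2), of n] by simp
    qed simp
    then show ?case
      by (simp add: total_balls_def)
  qed
qed

text \<open>The conditional mean of \<open>X (Suc n) k\<close> given \<open>\<G> n\<close>, tested against integrable \<open>\<G> n\<close>-measurable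
  functions.\<close>

lemma draw_mean:
  assumes k: "k \<in> {1..d}" and g: "g \<in> borel_measurable (\<G> n)" "integrable M g"
  shows "(\<integral>\<omega>. g \<omega> * real (X (Suc n) k \<omega>) \<partial>M)
       = (\<integral>\<omega>. g \<omega> * (real (N (Suc n) \<omega>) * balls n k \<omega> / total_balls n \<omega>) \<partial>M)"
proof -
  interpret G: finite_measure_subalgebra M "\<G> n"
    by unfold_locales (rule subalgebra_M_G)
  have [measurable]: "g \<in> borel_measurable M"
    using g(2) by simp
  define P where "P = Pi\<^sub>E {1..d} (\<lambda>_. {..C1})"
  have finP: "finite P"
    unfolding P_def by (intro finite_PiE) auto
  define E where "E x = {\<omega> \<in> space M. \<forall>k\<in>{1..d}. X (Suc n) k \<omega> = x k}" for x
  have [measurable]: "X (Suc n) k \<in> measurable M (count_space UNIV)" if "k \<in> {1..d}" for k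
    using that by (intro measurable_X) auto
  have E[measurable]: "E x \<in> sets M" for x
    unfolding E_def by measurable
  let ?c = "\<lambda>x. real_cond_exp M (\<G> n) (indicator (E x))"
  have int: "integrable M (\<lambda>\<omega>. g \<omega> * indicator (E x) \<omega>)" for x
    using integrable_real_mult_indicator[OF E g(2)] .
  have cint: "integrable M (\<lambda>\<omega>. g \<omega> * ?c x \<omega>)"
    "(\<integral>\<omega>. g \<omega> * ?c x \<omega> \<partial>M) = (\<integral>\<omega>. g \<omega> * indicator (E x) \<omega> \<partial>M)" for x
    using G.real_cond_exp_intg[OF int g(1)] by auto
  have "(\<integral>\<omega>. g \<omega> * real (X (Suc n) k \<omega>) \<partial>M)
      = (\<integral>\<omega>. (\<Sum>x\<in>P. real (x k) * (g \<omega> * indicator (E x) \<omega>)) \<partial>M)"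
  proof (rule integral_cong_AE)
    show "AE \<omega> in M. g \<omega> * real (X (Suc n) k \<omega>) = (\<Sum>x\<in>P. real (x k) * (g \<omega> * indicator (E x) \<omega>))"
      using draws_le[of n] AE_space
    proof eventually_elim
      case (elim \<omega>)
      let ?x = "restrict (\<lambda>k. X (Suc n) k \<omega>) {1..d}"
      have xP: "?x \<in> P"
        using elim by (auto simp: P_def)
      \<comment> \<open>The \<open>E x\<close> with \<open>x \<in> P\<close> are disjoint and almost surely exhaustive, as draws are at most \<open>C1\<close>.\<close>
      have "\<omega> \<in> E x \<longleftrightarrow> x = ?x" if "x \<in> P" for x
        using that elim(2) by (auto simp: E_def P_def PiE_def extensional_def fun_eq_iff)
      then have "(\<Sum>x\<in>P. real (x k) * (g \<omega> * indicator (E x) \<omega>))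
          = (\<Sum>x\<in>P. if x = ?x then real (?x k) * g \<omega> else 0)"
        by (intro sum.cong) (auto simp: indicator_def)
      also have "\<dots> = real (X (Suc n) k \<omega>) * g \<omega>"
        using xP finP k by (simp only: sum.delta) simp
      finally show ?case
        by simp
    qed
  qed (use k in measurable)
  also have "\<dots> = (\<Sum>x\<in>P. real (x k) * (\<integral>\<omega>. g \<omega> * ?c x \<omega> \<partial>M))"
    using int cint(2) by (subst Bochner_Integration.integral_sum) auto
  also have "\<dots> = (\<integral>\<omega>. (\<Sum>x\<in>P. real (x k) * (g \<omega> * ?c x \<omega>)) \<partial>M)"
    using cint(1) by (subst Bochner_Integration.integral_sum) auto
  also have "\<dots> = (\<integral>\<omega>. g \<omega> * (real (N (Suc n) \<omega>) * balls n k \<omega> / total_balls n \<omega>) \<partial>M)"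
  proof (rule integral_cong_AE)
    have "AE \<omega> in M. \<forall>x\<in>P. ?c x \<omega> = mv_hypergeometric d (\<lambda>k. urn_comp H0 X A n k \<omega>) (N (Suc n) \<omega>) x"
      by (rule AE_ball_countable') (use draw_law finP in \<open>auto simp: E_def intro: countable_finite\<close>)
    then show "AE \<omega> in M. (\<Sum>x\<in>P. real (x k) * (g \<omega> * ?c x \<omega>))
        = g \<omega> * (real (N (Suc n) \<omega>) * balls n k \<omega> / total_balls n \<omega>)"
      using AE_space
    proof eventually_elim
      case (elim \<omega>)
      have "(\<Sum>x\<in>P. real (x k) * (g \<omega> * ?c x \<omega>))
          = g \<omega> * (\<Sum>x\<in>P. real (x k) * mv_hypergeometric d (\<lambda>k. urn_comp H0 X A n k \<omega>) (N (Suc n) \<omega>) x)"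
        unfolding sum_distrib_left using elim(1) by (intro sum.cong) auto
      also have "(\<Sum>x\<in>P. real (x k) * mv_hypergeometric d (\<lambda>k. urn_comp H0 X A n k \<omega>) (N (Suc n) \<omega>) x)
          = real (N (Suc n) \<omega>) * balls n k \<omega> / total_balls n \<omega>"
        unfolding P_def balls_def total_balls_def urn_total_def
        using k N_bounds[OF elim(2), of n]
        by (intro mv_hypergeometric_mean) (auto simp: urn_total_def)
      finally show ?case .
    qed
  qed (use k in measurable)
  finally show ?thesis .
qed

text \<open>Factors depending on the replacement at stage \<open>n + 1\<close> split off by independence.\<close>

lemma replacement_product:
  assumes k: "k \<in> {1..d}" and \<phi>: "integrable M (\<lambda>\<omega>. \<phi> (A (Suc n) k \<omega>) :: real)"
    and g: "g \<in> borel_measurable (\<H> n)" "integrable M g"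
  shows "integrable M (\<lambda>\<omega>. \<phi> (A (Suc n) k \<omega>) * g \<omega>)"
    and "(\<integral>\<omega>. \<phi> (A (Suc n) k \<omega>) * g \<omega> \<partial>M) = (\<integral>\<omega>. \<phi> (A (Suc n) k \<omega>) \<partial>M) * (\<integral>\<omega>. g \<omega> \<partial>M)"
proof -
  let ?R = "sigma_of (space M) {A (Suc n) k | k. k \<in> {1..d}}"
  have sub: "subalgebra M ?R"
    by (rule subalgebra_sigma_of) (auto intro: measurable_A)
  have \<phi>R: "(\<lambda>\<omega>. \<phi> (A (Suc n) k \<omega>)) \<in> borel_measurable ?R"
    using k by (intro measurable_compose[OF measurable_sigma_of, where g=\<phi>]) auto
  have gen: "sigma_sets (space M) {f -` B \<inter> space M | B. B \<in> sets borel} \<subseteq> sets F"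
    if "subalgebra M F" "f \<in> borel_measurable F" for f :: "'a \<Rightarrow> real" and F
  proof -
    have "f -` B \<inter> space M \<in> sets F" if "B \<in> sets borel" for B
      using measurable_sets[OF \<open>f \<in> borel_measurable F\<close> that] \<open>subalgebra M F\<close>
      by (simp add: subalgebra_def)
    then have "sigma_sets (space F) {f -` B \<inter> space M | B. B \<in> sets borel} \<subseteq> sets F"
      by (intro sets.sigma_sets_subset) blast
    then show ?thesis
      using \<open>subalgebra M F\<close> by (simp add: subalgebra_def)
  qed
  have "indep_var borel (\<lambda>\<omega>. \<phi> (A (Suc n) k \<omega>)) borel g"
    unfolding indep_var_eq
  proof (intro conjI)
    show "indep_set (sigma_sets (space M) {(\<lambda>\<omega>. \<phi> (A (Suc n) k \<omega>)) -` B \<inter> space M | B. B \<in> sets borel})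
        (sigma_sets (space M) {g -` B \<inter> space M | B. B \<in> sets borel})"
      using replacement_indep[of n] gen[OF sub \<phi>R] gen[OF subalgebra_M_GX g(1)]
      unfolding indep_sets2_eq by blast
  qed (use \<phi> g in auto)
  from indep_var_integrable[OF this \<phi> g(2)] indep_var_lebesgue_integral[OF this \<phi> g(2)]
  show "integrable M (\<lambda>\<omega>. \<phi> (A (Suc n) k \<omega>) * g \<omega>)"
    "(\<integral>\<omega>. \<phi> (A (Suc n) k \<omega>) * g \<omega> \<partial>M) = (\<integral>\<omega>. \<phi> (A (Suc n) k \<omega>) \<partial>M) * (\<integral>\<omega>. g \<omega> \<partial>M)"
    by auto
qed

section \<open>Summability of the expected inverse sizes\<close>

text \<open>The supermartingale estimate. With \<open>I n\<close> the mean of \<open>1 / balls n k\<close>, the difference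
  \<open>I n - I (Suc n)\<close> is at least \<open>1 / (1 + C1)\<close> times the mean of \<open>1 / (total_balls n * balls n k)\<close>,
  and the sum of these differences is at most \<open>I 0\<close>.\<close>

lemma summable_inverse_total_balls:
  assumes k: "k \<in> {1..d}"
  shows "integrable M (\<lambda>\<omega>. 1 / (total_balls n \<omega> * balls n k \<omega>))"
    and "summable (\<lambda>n. \<integral>\<omega>. 1 / (total_balls n \<omega> * balls n k \<omega>) \<partial>M)"
proof -
  note [measurable] = measurable_M(1)[OF k] measurable_M(4)[OF k] measurable_M(5)[OF k]
  note b1 = balls_ge_1[OF k]
  define a where "a n = (\<integral>\<omega>. 1 / (total_balls n \<omega> * balls n k \<omega>) \<partial>M)" for n
  define I where "I n = (\<integral>\<omega>. 1 / balls n k \<omega> \<partial>M)" for n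
  define c where "c = 1 + real C1"
  have c: "1 \<le> c"
    by (simp add: c_def)
  have inv_le: "1 / x \<le> 1" "0 \<le> 1 / x" if "1 \<le> x" for x :: real
    using that by auto
  have tb: "1 \<le> total_balls n \<omega> * balls n k \<omega>" for n \<omega>
    using mult_mono[OF total_balls_ge_1[of n \<omega>] b1[of n \<omega>]] total_balls_ge_1[of n \<omega>] by simp
  have bb: "1 \<le> c * (balls n k \<omega>)\<^sup>2" for n \<omega>
    using mult_mono[OF c one_le_power[OF b1[of n \<omega>], of 2]] c by simp
  show int_a: "integrable M (\<lambda>\<omega>. 1 / (total_balls n \<omega> * balls n k \<omega>))" for n
    by (rule AE_bounded_integrable[where B=1]) (use inv_le[OF tb] in auto)
  have int_I: "integrable M (\<lambda>\<omega>. 1 / balls n k \<omega>)" for n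
    by (rule AE_bounded_integrable[where B=1]) (use inv_le[OF b1] in auto)
  have step: "a n / c \<le> I n - I (Suc n)" for n
  proof -
    let ?g = "\<lambda>\<omega>. 1 / (c * (balls n k \<omega>)\<^sup>2)"
    have integrable_C1_a: "integrable M (\<lambda>\<omega>. real C1 * (1 / (total_balls n \<omega> * balls n k \<omega>) / c))"
      by (intro Bochner_Integration.integrable_mult_right integrable_divide_zero int_a)
    have gG: "?g \<in> borel_measurable (\<G> n)"
      using measurable_F_G[OF balls_measurable_F[OF k]] by measurable
    have int_g: "integrable M ?g"
      by (rule AE_bounded_integrable[where B=1]) (use inv_le[OF bb] in auto)
    have int_gX: "integrable M (\<lambda>\<omega>. ?g \<omega> * real (X (Suc n) k \<omega>))"
    proof (rule AE_bounded_integrable[where B="real C1"])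
      show "AE \<omega> in M. \<bar>?g \<omega> * real (X (Suc n) k \<omega>)\<bar> \<le> real C1"
        using draws_le[of n]
      proof eventually_elim
        case (elim \<omega>)
        then show ?case
          using mult_mono[OF inv_le(1)[OF bb[of n \<omega>]], of "real (X (Suc n) k \<omega>)" "real C1"] k c
          by (simp add: abs_mult)
      qed
    qed measurable
    have "a n / c = (\<integral>\<omega>. 1 / (total_balls n \<omega> * balls n k \<omega>) / c \<partial>M)"
      unfolding a_def by (rule integral_divide_zero[symmetric])
    also have "\<dots> \<le> (\<integral>\<omega>. ?g \<omega> * (real (N (Suc n) \<omega>) * balls n k \<omega> / total_balls n \<omega>) \<partial>M)"
    proof (rule integral_mono)
      have eq: "?g \<omega> * (real (N (Suc n) \<omega>) * balls n k \<omega> / total_balls n \<omega>)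
          = real (N (Suc n) \<omega>) * (1 / (total_balls n \<omega> * balls n k \<omega>) / c)" for \<omega>
        using b1[of n \<omega>] total_balls_ge_1[of n \<omega>] c by (simp add: field_simps power2_eq_square)
      show "1 / (total_balls n \<omega> * balls n k \<omega>) / c \<le> ?g \<omega> * (real (N (Suc n) \<omega>) * balls n k \<omega> / total_balls n \<omega>)"
        if "\<omega> \<in> space M" for \<omega>
        unfolding eq using N_bounds(1)[OF that, of n] tb[of n \<omega>] c
          mult_right_mono[of 1 "real (N (Suc n) \<omega>)" "1 / (total_balls n \<omega> * balls n k \<omega>) / c"] by simp
      show "integrable M (\<lambda>\<omega>. ?g \<omega> * (real (N (Suc n) \<omega>) * balls n k \<omega> / total_balls n \<omega>))"
        unfolding eq
      proof (rule Bochner_Integration.integrable_bound[of M "\<lambda>\<omega>. real C1 * (1 / (total_balls n \<omega> * balls n k \<omega>) / c)"])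
        show "AE \<omega> in M. norm (real (N (Suc n) \<omega>) * (1 / (total_balls n \<omega> * balls n k \<omega>) / c))
            \<le> norm (real C1 * (1 / (total_balls n \<omega> * balls n k \<omega>) / c))"
        proof (rule AE_I2)
          fix \<omega> assume "\<omega> \<in> space M"
          then show "norm (real (N (Suc n) \<omega>) * (1 / (total_balls n \<omega> * balls n k \<omega>) / c))
            \<le> norm (real C1 * (1 / (total_balls n \<omega> * balls n k \<omega>) / c))"
            unfolding norm_mult using N_bounds(2)[of \<omega> n] by (intro mult_right_mono) auto
        qed
      qed (use integrable_C1_a in simp_all)
    qed (intro integrable_divide_zero int_a)
    also have "\<dots> = (\<integral>\<omega>. ?g \<omega> * real (X (Suc n) k \<omega>) \<partial>M)"
      using draw_mean[OF k gG int_g] by simp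
    also have "\<dots> \<le> (\<integral>\<omega>. 1 / balls n k \<omega> - 1 / balls (Suc n) k \<omega> \<partial>M)"
    proof (rule integral_mono_AE)
      show "AE \<omega> in M. ?g \<omega> * real (X (Suc n) k \<omega>) \<le> 1 / balls n k \<omega> - 1 / balls (Suc n) k \<omega>"
        using draws_le[of n] AE_space
      proof eventually_elim
        case (elim \<omega>)
        define x y b where "x = real (X (Suc n) k \<omega>)"
          and "y = real (A (Suc n) k \<omega>) * real (X (Suc n) k \<omega>)" and "b = balls n k \<omega>"
        \<comment> \<open>Replacing \<open>A \<ge> 1\<close> by \<open>1\<close> only lessens the decrease of \<open>1 / balls\<close>, and \<open>X \<le> C1\<close> bounds it below.\<close>
        have xy: "x \<le> y"
          unfolding x_def y_def using replacement_ge_1[OF k elim(2), of n]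
          by (metis mult_le_cancel_right1 of_nat_0_le_iff not_less of_nat_1 of_nat_le_iff)
        have x: "0 \<le> x" "x \<le> real C1"
          using elim k by (auto simp: x_def)
        have b: "1 \<le> b"
          using b1 by (simp add: b_def)
        have "b + x \<le> c * b"
          using x(2) mult_left_mono[OF b, of "real C1"] by (simp add: c_def algebra_simps)
        then have "x / (c * b\<^sup>2) \<le> x / (b * (b + x))"
          using x b c by (intro divide_left_mono) (auto simp: power2_eq_square mult_ac intro!: mult_pos_pos add_pos_nonneg)
        also have "\<dots> = 1 / b - 1 / (b + x)"
          using x b by (simp add: field_simps)
        also have "\<dots> \<le> 1 / b - 1 / (b + y)"
          using x b xy by (simp add: frac_le)
        finally show ?case
          unfolding balls_Suc(1)[OF k] by (simp add: x_def y_def b_def)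
      qed
    qed (use int_gX int_I in auto)
    also have "\<dots> = I n - I (Suc n)"
      using int_I by (simp add: I_def)
    finally show ?thesis .
  qed
  have "(\<Sum>i<n. a i) \<le> c * I 0" for n
  proof -
    have "(\<Sum>i<n. a i / c) \<le> (\<Sum>i<n. I i - I (Suc i))"
      by (intro sum_mono step)
    also have "\<dots> = I 0 - I n"
      by (rule sum_lessThan_telescope')
    also have "\<dots> \<le> I 0"
      unfolding I_def using b1 by (simp add: order_trans[OF zero_le_one])
    finally show ?thesis
      using c by (simp add: sum_divide_distrib[symmetric] field_simps)
  qed
  moreover have "0 \<le> a n" for n
    unfolding a_def using tb by (intro integral_nonneg_AE AE_I2) (metis inv_le(2))
  ultimately show "summable (\<lambda>n. \<integral>\<omega>. 1 / (total_balls n \<omega> * balls n k \<omega>) \<partial>M)"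
    unfolding a_def[symmetric] by (rule summableI_nonneg_bounded[rotated])
qed

section \<open>Logarithmic increments\<close>

lemma growth_measurable: "k \<in> {1..d} \<Longrightarrow> growth n k \<in> borel_measurable (\<F> (Suc n))"
  unfolding growth_def[abs_def]
  by (intro borel_measurable_divide borel_measurable_times A_measurable_F measurable_GX_F
      X_measurable_GX measurable_G_GX measurable_F_G balls_measurable_F)

lemma growth_nonneg: "k \<in> {1..d} \<Longrightarrow> 0 \<le> growth n k \<omega>"
  using balls_ge_1[of k n \<omega>] by (simp add: growth_def)

lemma growth_second_moment:
  assumes k: "k \<in> {1..d}" and A: "integrable M (\<lambda>\<omega>. (real (A (Suc n) k \<omega>))\<^sup>2)"
  shows "integrable M (\<lambda>\<omega>. (growth n k \<omega>)\<^sup>2)"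
    and "(\<integral>\<omega>. (growth n k \<omega>)\<^sup>2 \<partial>M) \<le> (\<integral>\<omega>. (real (A (Suc n) k \<omega>))\<^sup>2 \<partial>M) *
      ((real C1)\<^sup>2 * (\<integral>\<omega>. 1 / (total_balls n \<omega> * balls n k \<omega>) \<partial>M))"
proof -
  note [measurable] = measurable_M(1)[OF k] measurable_M(4)[OF k] measurable_M(5)[OF k]
  note b1 = balls_ge_1[OF k]
  let ?X = "\<lambda>\<omega>. real (X (Suc n) k \<omega>)"
  let ?g = "\<lambda>\<omega>. (?X \<omega>)\<^sup>2 / (balls n k \<omega>)\<^sup>2"
  let ?h = "\<lambda>\<omega>. 1 / (balls n k \<omega>)\<^sup>2"
  have b2: "1 \<le> (balls n k \<omega>)\<^sup>2" for \<omega>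
    using b1 by simp
  have h_bound: "0 \<le> ?h \<omega>" "?h \<omega> \<le> 1" for \<omega>
    using b2[of \<omega>] by (auto simp del: one_le_power simp add: divide_le_eq_1)
  have hG: "?h \<in> borel_measurable (\<G> n)"
    using measurable_F_G[OF balls_measurable_F[OF k]] by measurable
  have int_h: "integrable M ?h"
    by (rule AE_bounded_integrable[where B=1]) (use h_bound in auto)
  have gGX: "?g \<in> borel_measurable (\<H> n)"
    using measurable_G_GX[OF measurable_F_G[OF balls_measurable_F[OF k]]] X_measurable_GX[OF k] by measurable
  have int_hX: "integrable M (\<lambda>\<omega>. ?h \<omega> * ?X \<omega>)"
  proof (rule AE_bounded_integrable[where B="real C1"])
    show "AE \<omega> in M. \<bar>?h \<omega> * ?X \<omega>\<bar> \<le> real C1"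
      using draws_le[of n]
    proof eventually_elim
      case (elim \<omega>)
      then show ?case
        using mult_mono[OF h_bound(2)[of \<omega>], of "?X \<omega>" "real C1"] k by (simp add: abs_mult)
    qed
  qed measurable
  have g_le: "AE \<omega> in M. ?g \<omega> \<le> real C1 * (?h \<omega> * ?X \<omega>)"
    using draws_le[of n]
  proof eventually_elim
    case (elim \<omega>)
    then have "(?X \<omega>)\<^sup>2 \<le> real C1 * ?X \<omega>"
      using k by (auto simp: power2_eq_square intro!: mult_right_mono)
    then show ?case
      using divide_right_mono[of _ _ "(balls n k \<omega>)\<^sup>2"] by simp
  qed
  have int_C1hX: "integrable M (\<lambda>\<omega>. real C1 * (?h \<omega> * ?X \<omega>))"
    by (rule Bochner_Integration.integrable_mult_right[OF int_hX])
  have int_g: "integrable M ?g"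
  proof (rule Bochner_Integration.integrable_bound[OF int_C1hX])
    show "AE \<omega> in M. norm (?g \<omega>) \<le> norm (real C1 * (?h \<omega> * ?X \<omega>))"
      using g_le by eventually_elim simp
  qed measurable
  have sq: "(growth n k \<omega>)\<^sup>2 = (real (A (Suc n) k \<omega>))\<^sup>2 * ?g \<omega>" for \<omega>
    by (simp add: growth_def power_mult_distrib power_divide)
  show "integrable M (\<lambda>\<omega>. (growth n k \<omega>)\<^sup>2)"
    unfolding sq by (rule replacement_product(1)[OF k A gGX int_g])
  have "(\<integral>\<omega>. ?g \<omega> \<partial>M) \<le> (\<integral>\<omega>. real C1 * (?h \<omega> * ?X \<omega>) \<partial>M)"
    by (rule integral_mono_AE[OF int_g int_C1hX g_le])
  also have "\<dots> = real C1 * (\<integral>\<omega>. ?h \<omega> * (real (N (Suc n) \<omega>) * balls n k \<omega> / total_balls n \<omega>) \<partial>M)"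
    unfolding draw_mean[OF k hG int_h, symmetric] by (rule integral_mult_right_zero)
  also have "\<dots> \<le> real C1 * (\<integral>\<omega>. real C1 * (1 / (total_balls n \<omega> * balls n k \<omega>)) \<partial>M)"
  proof (intro mult_left_mono integral_mono')
    show "integrable M (\<lambda>\<omega>. real C1 * (1 / (total_balls n \<omega> * balls n k \<omega>)))"
      by (intro Bochner_Integration.integrable_mult_right summable_inverse_total_balls(1)[OF k])
    fix \<omega> assume "\<omega> \<in> space M"
    have "?h \<omega> * (real (N (Suc n) \<omega>) * balls n k \<omega> / total_balls n \<omega>)
        = real (N (Suc n) \<omega>) * (1 / (total_balls n \<omega> * balls n k \<omega>))"
      using b1[of n \<omega>] total_balls_ge_1[of n \<omega>] by (simp add: field_simps power2_eq_square)
    also have "\<dots> \<le> real C1 * (1 / (total_balls n \<omega> * balls n k \<omega>))"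
      using N_bounds(2)[OF \<open>\<omega> \<in> space M\<close>, of n] b1[of n \<omega>] total_balls_ge_1[of n \<omega>]
      by (intro mult_right_mono) auto
    finally show "?h \<omega> * (real (N (Suc n) \<omega>) * balls n k \<omega> / total_balls n \<omega>)
        \<le> real C1 * (1 / (total_balls n \<omega> * balls n k \<omega>))" .
    show "0 \<le> real C1 * (1 / (total_balls n \<omega> * balls n k \<omega>))"
      using b1[of n \<omega>] total_balls_ge_1[of n \<omega>] by simp
  qed auto
  also have "\<dots> = (real C1)\<^sup>2 * (\<integral>\<omega>. 1 / (total_balls n \<omega> * balls n k \<omega>) \<partial>M)"
    unfolding integral_mult_right_zero by (simp only: power2_eq_square mult.assoc)
  finally have "(\<integral>\<omega>. ?g \<omega> \<partial>M) \<le> (real C1)\<^sup>2 * (\<integral>\<omega>. 1 / (total_balls n \<omega> * balls n k \<omega>) \<partial>M)" .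
  then show "(\<integral>\<omega>. (growth n k \<omega>)\<^sup>2 \<partial>M) \<le> (\<integral>\<omega>. (real (A (Suc n) k \<omega>))\<^sup>2 \<partial>M) *
      ((real C1)\<^sup>2 * (\<integral>\<omega>. 1 / (total_balls n \<omega> * balls n k \<omega>) \<partial>M))"
    unfolding sq replacement_product(2)[OF k A gGX int_g] by (intro mult_left_mono) auto
qed

text \<open>The conditional mean of \<open>growth n k\<close> given \<open>\<G> n\<close>, for integrable replacements.\<close>

definition drift :: "nat \<Rightarrow> nat \<Rightarrow> 'a \<Rightarrow> real"
  where "drift n k \<omega> = urn_mean M A (Suc n) k * (real (N (Suc n) \<omega>) / total_balls n \<omega>)"

lemma drift_measurable_G: "drift n k \<in> borel_measurable (\<G> n)"
  unfolding drift_def[abs_def]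
  by (intro borel_measurable_times borel_measurable_const borel_measurable_divide
      N_measurable_G measurable_F_G total_balls_measurable_F)

lemma drift_measurable: "drift n k \<in> borel_measurable (\<F> (Suc n))"
  by (intro measurable_GX_F measurable_G_GX drift_measurable_G)

lemma sample_ratio_bounds:
  assumes "\<omega> \<in> space M"
  shows "0 \<le> real (N (Suc n) \<omega>) / total_balls n \<omega>" "real (N (Suc n) \<omega>) / total_balls n \<omega> \<le> 1"
  using N_bounds(3)[OF assms, of n] total_balls_ge_1[of n \<omega>] by (auto simp: total_balls_def)

text \<open>The martingale difference property of \<open>growth n k - drift n k\<close> for the filtration \<open>\<F>\<close>:
  independence turns the replacement into its mean, and the mean of the draw cancels the drift.\<close>

lemma growth_minus_drift_orthogonal:
  assumes k: "k \<in> {1..d}" and A: "integrable M (\<lambda>\<omega>. (real (A (Suc n) k \<omega>))\<^sup>2)"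
    and g: "g \<in> borel_measurable (\<F> n)" "integrable M (\<lambda>\<omega>. (g \<omega>)\<^sup>2)"
  shows "(\<integral>\<omega>. g \<omega> * (growth n k \<omega> - drift n k \<omega>) \<partial>M) = 0"
proof -
  note [measurable] = measurable_M(1)[OF k] measurable_M(4)[OF k] measurable_M(5)[OF k]
  note b1 = balls_ge_1[OF k]
  have [measurable]: "g \<in> borel_measurable M"
    by (rule measurable_from_subalg[OF subalgebra_M_F g(1)])
  have int_g: "integrable M g"
    by (rule integrable_of_square[OF _ g(2)]) simp
  let ?X = "\<lambda>\<omega>. real (X (Suc n) k \<omega>)"
  let ?h = "\<lambda>\<omega>. g \<omega> / balls n k \<omega>"
  have int_A: "integrable M (\<lambda>\<omega>. real (A (Suc n) k \<omega>))"
    by (rule integrable_of_square[OF _ A]) simp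
  have h_le: "\<bar>?h \<omega>\<bar> \<le> \<bar>g \<omega>\<bar>" for \<omega>
    using b1[of n \<omega>] mult_left_mono[of 1 "balls n k \<omega>" "\<bar>g \<omega>\<bar>"] by (simp add: abs_div divide_le_eq)
  have hG: "?h \<in> borel_measurable (\<G> n)"
    using measurable_F_G[OF balls_measurable_F[OF k]] measurable_F_G[OF g(1)] by measurable
  have int_h: "integrable M ?h"
    by (rule Bochner_Integration.integrable_bound[OF int_g]) (use h_le in auto)
  have hX: "(\<lambda>\<omega>. ?h \<omega> * ?X \<omega>) \<in> borel_measurable (\<H> n)"
    by (intro borel_measurable_times measurable_G_GX hG X_measurable_GX k)
  have int_hX: "integrable M (\<lambda>\<omega>. ?h \<omega> * ?X \<omega>)"
  proof (rule Bochner_Integration.integrable_bound[of M "\<lambda>\<omega>. real C1 * g \<omega>"])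
    show "AE \<omega> in M. norm (?h \<omega> * ?X \<omega>) \<le> norm (real C1 * g \<omega>)"
      using draws_le[of n]
    proof eventually_elim
      case (elim \<omega>)
      then show ?case
        using mult_mono[OF h_le[of \<omega>], of "?X \<omega>" "real C1"] k by (simp add: abs_mult mult.commute)
    qed
  qed (use int_g in auto)
  have int_gN: "integrable M (\<lambda>\<omega>. g \<omega> * (real (N (Suc n) \<omega>) / total_balls n \<omega>))"
  proof (rule Bochner_Integration.integrable_bound[OF int_g])
    show "AE \<omega> in M. norm (g \<omega> * (real (N (Suc n) \<omega>) / total_balls n \<omega>)) \<le> norm (g \<omega>)"
    proof (rule AE_I2)
      fix \<omega> assume "\<omega> \<in> space M"
      then show "norm (g \<omega> * (real (N (Suc n) \<omega>) / total_balls n \<omega>)) \<le> norm (g \<omega>)"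
        unfolding norm_mult using sample_ratio_bounds[of \<omega> n] by (intro mult_left_le) auto
    qed
  qed measurable
  have gr: "g \<omega> * growth n k \<omega> = real (A (Suc n) k \<omega>) * (?h \<omega> * ?X \<omega>)" for \<omega>
    by (simp add: growth_def)
  have dr: "g \<omega> * drift n k \<omega> = urn_mean M A (Suc n) k * (g \<omega> * (real (N (Suc n) \<omega>) / total_balls n \<omega>))" for \<omega>
    by (simp add: drift_def)
  have "(\<integral>\<omega>. g \<omega> * growth n k \<omega> \<partial>M) = urn_mean M A (Suc n) k * (\<integral>\<omega>. ?h \<omega> * ?X \<omega> \<partial>M)"
    unfolding gr urn_mean_def by (rule replacement_product(2)[OF k int_A hX int_hX])
  also have "(\<integral>\<omega>. ?h \<omega> * ?X \<omega> \<partial>M)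
      = (\<integral>\<omega>. ?h \<omega> * (real (N (Suc n) \<omega>) * balls n k \<omega> / total_balls n \<omega>) \<partial>M)"
    by (rule draw_mean[OF k hG int_h])
  also have "\<dots> = (\<integral>\<omega>. g \<omega> * (real (N (Suc n) \<omega>) / total_balls n \<omega>) \<partial>M)"
  proof (rule Bochner_Integration.integral_cong[OF refl])
    fix \<omega>
    show "?h \<omega> * (real (N (Suc n) \<omega>) * balls n k \<omega> / total_balls n \<omega>) = g \<omega> * (real (N (Suc n) \<omega>) / total_balls n \<omega>)"
      using b1[of n \<omega>] by simp
  qed
  finally have eq: "(\<integral>\<omega>. g \<omega> * growth n k \<omega> \<partial>M) = (\<integral>\<omega>. g \<omega> * drift n k \<omega> \<partial>M)"
    unfolding dr by (simp only: Bochner_Integration.integral_mult_right_zero)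
  have "integrable M (\<lambda>\<omega>. g \<omega> * growth n k \<omega>)"
    unfolding gr by (rule replacement_product(1)[OF k int_A hX int_hX])
  moreover have "integrable M (\<lambda>\<omega>. g \<omega> * drift n k \<omega>)"
    unfolding dr by (intro Bochner_Integration.integrable_mult_right int_gN)
  ultimately show ?thesis
    using eq by (simp add: right_diff_distrib)
qed

text \<open>The summand differs from the martingale difference \<open>growth n k - drift n k\<close> by at most
  \<open>(growth n k)\<^sup>2\<close>, since \<open>\<bar>ln (1 + x) - x\<bar> \<le> x\<^sup>2\<close> for \<open>x \<ge> 0\<close>.\<close>

lemma AE_summable_log_increment:
  assumes k: "k \<in> {1..d}"
    and A: "\<And>n. integrable M (\<lambda>\<omega>. (real (A (Suc n) k \<omega>))\<^sup>2)"
    and K: "\<And>n. (\<integral>\<omega>. (real (A (Suc n) k \<omega>))\<^sup>2 \<partial>M) \<le> K"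
  shows "AE \<omega> in M. summable (\<lambda>n. ln (balls (Suc n) k \<omega>) - ln (balls n k \<omega>) - drift n k \<omega>)"
proof -
  note [measurable] = measurable_M(1)[OF k] measurable_M(4)[OF k] measurable_M(5)[OF k]
  note b1 = balls_ge_1[OF k]
  have [measurable]: "growth n k \<in> borel_measurable M" "drift n k \<in> borel_measurable M" for n
    using measurable_from_subalg[OF subalgebra_M_F] growth_measurable[OF k] drift_measurable by blast+
  define a where "a n = (\<integral>\<omega>. 1 / (total_balls n \<omega> * balls n k \<omega>) \<partial>M)" for n
  have summ_a: "summable a"
    using summable_inverse_total_balls(2)[OF k] by (simp add: a_def[abs_def])
  have a0: "0 \<le> a n" for n
    unfolding a_def using b1 total_balls_ge_1 by (intro integral_nonneg_AE AE_I2) (simp add: order_trans[OF zero_le_one])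
  define U where "U n = (\<integral>\<omega>. (growth n k \<omega>)\<^sup>2 \<partial>M)" for n
  have int_U: "integrable M (\<lambda>\<omega>. (growth n k \<omega>)\<^sup>2)" for n
    by (rule growth_second_moment(1)[OF k A])
  have U_le: "U n \<le> K * (real C1)\<^sup>2 * a n" for n
  proof -
    have "U n \<le> (\<integral>\<omega>. (real (A (Suc n) k \<omega>))\<^sup>2 \<partial>M) * ((real C1)\<^sup>2 * a n)"
      unfolding U_def a_def by (rule growth_second_moment(2)[OF k A])
    also have "\<dots> \<le> K * ((real C1)\<^sup>2 * a n)"
      by (intro mult_right_mono K) (use a0 in auto)
    finally show ?thesis by (simp add: mult.assoc)
  qed
  have U0: "0 \<le> U n" for n
    by (simp add: U_def)
  have summ_U: "summable U"
    by (rule summable_comparison_test'[OF summable_mult[OF summ_a, of "K * (real C1)\<^sup>2"], of 0])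
       (use U_le U0 in auto)
  define m where "m n = urn_mean M A (Suc n) k" for n
  have m: "0 \<le> m n" "m n \<le> K" for n
  proof -
    show "0 \<le> m n"
      by (simp add: m_def urn_mean_def)
    have "m n \<le> (\<integral>\<omega>. (real (A (Suc n) k \<omega>))\<^sup>2 \<partial>M)"
      unfolding m_def urn_mean_def
    proof (rule integral_mono[OF integrable_of_square[OF _ A] A])
      fix \<omega> assume "\<omega> \<in> space M"
      show "real (A (Suc n) k \<omega>) \<le> (real (A (Suc n) k \<omega>))\<^sup>2"
        using replacement_ge_1[OF k \<open>\<omega> \<in> space M\<close>, of n] by (simp add: power2_eq_square)
    qed simp
    then show "m n \<le> K"
      using K[of n] by simp
  qed
  define D where "D n \<omega> = growth n k \<omega> - drift n k \<omega>" for n \<omega>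
  have [measurable]: "D n \<in> borel_measurable M" for n
    unfolding D_def by measurable
  let ?B = "\<lambda>n \<omega>. 2 * (growth n k \<omega>)\<^sup>2 + 2 * (K\<^sup>2 * (real C1)\<^sup>2) * (1 / (total_balls n \<omega> * balls n k \<omega>))"
  have D_le: "(D n \<omega>)\<^sup>2 \<le> ?B n \<omega>" if "\<omega> \<in> space M" for n \<omega>
  proof -
    have "(D n \<omega>)\<^sup>2 \<le> 2 * (growth n k \<omega>)\<^sup>2 + 2 * (drift n k \<omega>)\<^sup>2"
      using zero_le_power2[of "growth n k \<omega> + drift n k \<omega>"] by (simp add: D_def power2_sum power2_diff)
    moreover have "(drift n k \<omega>)\<^sup>2 \<le> K\<^sup>2 * (real C1)\<^sup>2 * (1 / (total_balls n \<omega> * balls n k \<omega>))"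
    proof -
      have "drift n k \<omega> \<le> K * (real C1 / total_balls n \<omega>)"
        unfolding drift_def using m[of n] N_bounds(2)[OF that, of n] total_balls_ge_1[of n \<omega>]
        by (intro mult_mono divide_right_mono) (auto simp: m_def)
      moreover have "0 \<le> drift n k \<omega>"
        unfolding drift_def m_def[symmetric]
        by (intro mult_nonneg_nonneg m(1) sample_ratio_bounds(1) that)
      ultimately have "(drift n k \<omega>)\<^sup>2 \<le> (K * (real C1 / total_balls n \<omega>))\<^sup>2"
        by (intro power_mono)
      also have "\<dots> = K\<^sup>2 * (real C1)\<^sup>2 * (1 / (total_balls n \<omega> * total_balls n \<omega>))"
        by (simp add: power_mult_distrib power_divide power2_eq_square)
      also have "\<dots> \<le> K\<^sup>2 * (real C1)\<^sup>2 * (1 / (total_balls n \<omega> * balls n k \<omega>))"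
        using b1[of n \<omega>] total_balls_ge_1[of n \<omega>] balls_le_total[OF k, of n \<omega>]
        by (intro mult_left_mono divide_left_mono) auto
      finally show ?thesis .
    qed
    ultimately show ?thesis
      by simp
  qed
  have int_B: "integrable M (?B n)" for n
    by (intro Bochner_Integration.integrable_add Bochner_Integration.integrable_mult_right int_U
        summable_inverse_total_balls(1)[OF k])
  have int_D: "integrable M (\<lambda>\<omega>. (D n \<omega>)\<^sup>2)" for n
    by (rule Bochner_Integration.integrable_bound[OF int_B[of n]]) (use D_le in \<open>auto intro!: AE_I2 intro: order_trans[OF _ abs_ge_self]\<close>)
  have D2: "(\<integral>\<omega>. (D n \<omega>)\<^sup>2 \<partial>M) \<le> 2 * U n + 2 * (K\<^sup>2 * (real C1)\<^sup>2) * a n" for n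
  proof -
    have "(\<integral>\<omega>. (D n \<omega>)\<^sup>2 \<partial>M) \<le> (\<integral>\<omega>. ?B n \<omega> \<partial>M)"
      by (intro integral_mono int_D int_B D_le)
    also have "\<dots> = 2 * U n + 2 * (K\<^sup>2 * (real C1)\<^sup>2) * a n"
      using int_U summable_inverse_total_balls(1)[OF k, of n]
      by (subst Bochner_Integration.integral_add)
         (auto simp only: U_def a_def integral_mult_right_zero intro!: Bochner_Integration.integrable_mult_right)
    finally show ?thesis .
  qed
  have summ_D2: "summable (\<lambda>n. \<integral>\<omega>. (D n \<omega>)\<^sup>2 \<partial>M)"
    by (rule summable_comparison_test'[OF summable_add[OF summable_mult[OF summ_U, of 2]
          summable_mult[OF summ_a, of "2 * (K\<^sup>2 * (real C1)\<^sup>2)"]], of 0])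
       (use D2 in auto)
  have "AE \<omega> in M. summable (\<lambda>n. D n \<omega>)"
  proof (rule AE_summable_orthogonal[where F=\<F>])
    show "D n \<in> borel_measurable (\<F> (Suc n))" for n
      unfolding D_def by (intro borel_measurable_diff growth_measurable drift_measurable k)
    show "(\<integral>\<omega>. g \<omega> * D n \<omega> \<partial>M) = 0"
      if "g \<in> borel_measurable (\<F> n)" "integrable M (\<lambda>\<omega>. (g \<omega>)\<^sup>2)" for n g
      unfolding D_def using growth_minus_drift_orthogonal[OF k A that] .
  qed (use subalgebra_M_F subalgebra_F_Suc int_D summ_D2 in auto)
  moreover have "AE \<omega> in M. summable (\<lambda>n. (growth n k \<omega>)\<^sup>2)"
    by (rule AE_summable_of_summable_integral) (use int_U summ_U in \<open>auto simp: U_def[abs_def]\<close>)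
  ultimately show ?thesis
  proof eventually_elim
    case (elim \<omega>)
    have "summable (\<lambda>n. ln (1 + growth n k \<omega>) - growth n k \<omega>)"
      by (rule summable_comparison_test'[OF elim(2), of 0])
         (simp add: ln_one_plus_bound growth_nonneg[OF k])
    from summable_add[OF this elim(1)]
    have "summable (\<lambda>n. ln (1 + growth n k \<omega>) - drift n k \<omega>)"
      by (simp add: D_def)
    moreover have "ln (balls (Suc n) k \<omega>) - ln (balls n k \<omega>) = ln (1 + growth n k \<omega>)" for n
      using b1[of n \<omega>] growth_nonneg[OF k, of n \<omega>] unfolding balls_Suc(2)[OF k]
      by (simp add: ln_mult)
    ultimately show ?case
      by simp
  qed
qed

text \<open>Replacements are at least \<open>1\<close>, so the third moment dominates the second.\<close>

lemma second_moment_bound: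
  assumes k: "k \<in> {1..d}"
    and A3: "(SUP n\<in>{1..}. \<integral>\<^sup>+\<omega>. ennreal (real (A n k \<omega>) ^ 3) \<partial>M) < ennreal C2"
  shows "integrable M (\<lambda>\<omega>. (real (A (Suc n) k \<omega>))\<^sup>2)"
    and "(\<integral>\<omega>. (real (A (Suc n) k \<omega>))\<^sup>2 \<partial>M) \<le> C2"
proof -
  note [measurable] = measurable_M(5)[OF k]
  have C2: "0 \<le> C2"
    using A3 by (metis ennreal_neg linorder_le_cases not_less_zero)
  have "(\<integral>\<^sup>+\<omega>. ennreal ((real (A (Suc n) k \<omega>))\<^sup>2) \<partial>M) \<le> (\<integral>\<^sup>+\<omega>. ennreal (real (A (Suc n) k \<omega>) ^ 3) \<partial>M)"
  proof (intro nn_integral_mono ennreal_leI)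
    fix \<omega> assume "\<omega> \<in> space M"
    then show "(real (A (Suc n) k \<omega>))\<^sup>2 \<le> real (A (Suc n) k \<omega>) ^ 3"
      using replacement_ge_1[OF k, of \<omega> n] by (intro power_increasing) auto
  qed
  also have "\<dots> \<le> (SUP n\<in>{1..}. \<integral>\<^sup>+\<omega>. ennreal (real (A n k \<omega>) ^ 3) \<partial>M)"
    by (intro SUP_upper) auto
  also note less_imp_le[OF A3]
  finally have le: "(\<integral>\<^sup>+\<omega>. ennreal ((real (A (Suc n) k \<omega>))\<^sup>2) \<partial>M) \<le> ennreal C2" .
  show int: "integrable M (\<lambda>\<omega>. (real (A (Suc n) k \<omega>))\<^sup>2)"
    by (rule integrableI_bounded) (use le_less_trans[OF le ennreal_less_top] in auto)
  show "(\<integral>\<omega>. (real (A (Suc n) k \<omega>))\<^sup>2 \<partial>M) \<le> C2"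
    using le C2 by (simp add: nn_integral_eq_integral[OF int])
qed

lemma mean_ge_1:
  assumes k: "k \<in> {1..d}" and A: "integrable M (\<lambda>\<omega>. (real (A (Suc n) k \<omega>))\<^sup>2)"
  shows "1 \<le> urn_mean M A (Suc n) k"
proof -
  note [measurable] = measurable_M(5)[OF k]
  have "(\<integral>\<omega>. 1 \<partial>M) \<le> urn_mean M A (Suc n) k"
    unfolding urn_mean_def
    by (intro integral_mono integrable_of_square[OF _ A]) (use replacement_ge_1[OF k] in auto)
  then show ?thesis
    by (simp add: prob_space)
qed

text \<open>The sample size ratio \<open>N (Suc n) / total_balls n\<close> occurs in the drift of both colours, so that only the
  differences \<open>r n\<close> of the normalised means remain.\<close>

lemma AE_convergent_log_difference:
  assumes k: "k \<in> {1..d}" and j: "j \<in> {1..d}"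
    and Ak: "\<And>n. integrable M (\<lambda>\<omega>. (real (A (Suc n) k \<omega>))\<^sup>2)" "\<And>n. (\<integral>\<omega>. (real (A (Suc n) k \<omega>))\<^sup>2 \<partial>M) \<le> K"
    and Aj: "\<And>n. integrable M (\<lambda>\<omega>. (real (A (Suc n) j \<omega>))\<^sup>2)" "\<And>n. (\<integral>\<omega>. (real (A (Suc n) j \<omega>))\<^sup>2 \<partial>M) \<le> K"
    and p: "0 < p" and q: "0 < q"
    and summ: "(\<lambda>n. \<bar>urn_mean M A (n + 1) k * q - p * urn_mean M A (n + 1) j\<bar> / real n) summable_on {1..}"
  shows "AE \<omega> in M. convergent (\<lambda>n. ln (balls n k \<omega>) / p - ln (balls n j \<omega>) / q)"
proof -
  define r where "r n = urn_mean M A (Suc n) k / p - urn_mean M A (Suc n) j / q" for n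
  have "(\<lambda>n. \<bar>urn_mean M A (n + 1) k * q - p * urn_mean M A (n + 1) j\<bar> / real n) summable_on UNIV"
    using summ by (rule summable_on_cong_neutral[THEN iffD1, rotated -1]) auto
  then have "summable (\<lambda>n. \<bar>urn_mean M A (n + 1) k * q - p * urn_mean M A (n + 1) j\<bar> / real n)"
    by (rule summable_on_UNIV_nonneg_real_iff[THEN iffD1, rotated]) simp
  then have summ_r: "summable (\<lambda>n. real C1 / (p * q) *
      (\<bar>urn_mean M A (n + 1) k * q - p * urn_mean M A (n + 1) j\<bar> / real n))"
    by (rule summable_mult)
  have r_abs: "\<bar>r n\<bar> = \<bar>urn_mean M A (n + 1) k * q - p * urn_mean M A (n + 1) j\<bar> / (p * q)" for n
    using p q by (simp add: r_def diff_frac_eq abs_div abs_mult mult.commute)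
  show ?thesis
    using AE_summable_log_increment[OF k Ak] AE_summable_log_increment[OF j Aj] total_balls_ge AE_space
  proof eventually_elim
    case (elim \<omega>)
    let ?s = "\<lambda>n. real (N (Suc n) \<omega>) / total_balls n \<omega>"
    have "summable (\<lambda>n. ?s n * r n)"
    proof (rule summable_comparison_test'[OF summ_r, of 1])
      fix n :: nat assume n: "1 \<le> n"
      have "?s n \<le> real C1 / real n"
        using N_bounds(2)[OF elim(4), of n] elim(3)[rule_format, of n] n by (intro frac_le) auto
      then have "\<bar>?s n * r n\<bar> \<le> real C1 / real n * \<bar>r n\<bar>"
        unfolding abs_mult using sample_ratio_bounds(1)[OF elim(4), of n]
        by (intro mult_right_mono) auto
      then show "norm (?s n * r n) \<le> real C1 / (p * q) *
          (\<bar>urn_mean M A (n + 1) k * q - p * urn_mean M A (n + 1) j\<bar> / real n)"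
        unfolding r_abs by (simp add: mult.commute)
    qed
    from summable_add[OF summable_diff[OF summable_divide[OF elim(1), of p] summable_divide[OF elim(2), of q]] this]
    have "summable (\<lambda>n. (ln (balls (Suc n) k \<omega>) - ln (balls n k \<omega>) - drift n k \<omega>) / p
        - (ln (balls (Suc n) j \<omega>) - ln (balls n j \<omega>) - drift n j \<omega>) / q + ?s n * r n)" .
    moreover define L where "L n = ln (balls n k \<omega>) / p - ln (balls n j \<omega>) / q" for n
    have "(ln (balls (Suc n) k \<omega>) - ln (balls n k \<omega>) - drift n k \<omega>) / p
        - (ln (balls (Suc n) j \<omega>) - ln (balls n j \<omega>) - drift n j \<omega>) / q + ?s n * r n
        = L (Suc n) - L n" for n
      unfolding L_def r_def drift_def by (simp add: diff_divide_distrib add_divide_distrib algebra_simps)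
    ultimately have "summable (\<lambda>n. L (Suc n) - L n)"
      by simp
    then have "convergent (\<lambda>n. (\<Sum>i<n. L (Suc i) - L i))"
      by (simp add: summable_iff_convergent)
    then have "convergent (\<lambda>n. (L n - L 0) + L 0)"
      unfolding sum_lessThan_telescope by (intro convergent_add convergent_const)
    then show ?case
      by (simp add: L_def)
  qed
qed

end

section \<open>The limit of the ratios\<close>

theorem theorem3p5:
  fixes M :: "'a measure"
    and d C1 t :: nat
    and H0 :: "nat \<Rightarrow> nat"
    and N :: "nat \<Rightarrow> 'a \<Rightarrow> nat"
    and X A :: "nat \<Rightarrow> nat \<Rightarrow> 'a \<Rightarrow> nat"
    and C2 :: real
    and m :: "nat \<Rightarrow> real"
    and Nlim :: "'a \<Rightarrow> real"
  assumes urn: "multidraw_urn M d H0 C1 N X A"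
    and A1: "\<And>k. k \<in> {1..d} \<Longrightarrow>
      (SUP n\<in>{1..}. \<integral>\<^sup>+\<omega>. ennreal (real (A n k \<omega>) ^ 3) \<partial>M) < ennreal C2"
    and A2_lim: "\<And>k. k \<in> {1..d} \<Longrightarrow> (\<lambda>n. urn_mean M A n k) \<longlonglongrightarrow> m k"
    and A2_t: "t \<in> {1..d}"
    and A2_eq: "\<And>k. k \<in> {1..t} \<Longrightarrow> m k = m 1"
    and A2_gt: "t < d \<Longrightarrow> m t > m (t + 1)"
    and A2_ge: "\<And>k. t + 1 \<le> k \<Longrightarrow> k < d \<Longrightarrow> m k \<ge> m (k + 1)"
    and A2_mean_eq: "\<And>n k. n \<ge> 1 \<Longrightarrow> k \<in> {1..t} \<Longrightarrow> urn_mean M A n k = urn_mean M A n 1"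
    and A3: "\<And>k j. k \<in> {1..d} \<Longrightarrow> j \<in> {1..d} \<Longrightarrow>
      (\<lambda>n. \<bar>urn_mean M A (n + 1) k * m j - m k * urn_mean M A (n + 1) j\<bar> / real n) summable_on {1..}"
    and N_rv: "Nlim \<in> borel_measurable M"
    and N_lim: "AE \<omega> in M.
      (\<lambda>n. real_cond_exp M (urn_F M d N X A n) (\<lambda>\<omega>. real (N (n + 1) \<omega>)) \<omega>) \<longlonglongrightarrow> Nlim \<omega>"
  shows "\<forall>k\<in>{1..d}. \<forall>j\<in>{1..d} - {k}. \<exists>\<xi>\<in>borel_measurable M.
    (\<forall>\<omega>\<in>space M. \<xi> \<omega> \<in> {0<..}) \<and>
    (AE \<omega> in M. (\<lambda>n. real (urn_comp H0 X A n k \<omega>) / real (urn_comp H0 X A n j \<omega>) powr (m k / m j))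
       \<longlonglongrightarrow> (\<xi> \<omega> :: real))"
proof (intro ballI)
  interpret multidraw_urn M d H0 C1 N X A
    by (rule urn)
  fix k j assume k: "k \<in> {1..d}" and "j \<in> {1..d} - {k}"
  then have j: "j \<in> {1..d}"
    by blast
  note moment = second_moment_bound[OF _ A1]
  have m_pos: "0 < m i" if i: "i \<in> {1..d}" for i
  proof -
    have "1 \<le> m i"
    proof (rule LIMSEQ_le_const[OF A2_lim[OF i]])
      show "\<exists>n0. \<forall>n\<ge>n0. 1 \<le> urn_mean M A n i"
        using mean_ge_1[OF i moment(1)[OF i i]] by (metis Suc_le_D One_nat_def)
    qed
    then show ?thesis by simp
  qed
  define L where "L n \<omega> = ln (balls n k \<omega>) / m k - ln (balls n j \<omega>) / m j" for n \<omega>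
  have conv: "AE \<omega> in M. convergent (\<lambda>n. L n \<omega>)"
    unfolding L_def
    by (rule AE_convergent_log_difference[where K=C2]) (use k j moment m_pos A3 in auto)
  have [measurable]: "L n \<in> borel_measurable M" for n
    unfolding L_def[abs_def] using measurable_M(1)[OF k, of n] measurable_M(1)[OF j, of n] by measurable
  have ratio: "real (urn_comp H0 X A n k \<omega>) / real (urn_comp H0 X A n j \<omega>) powr (m k / m j)
      = exp (m k * L n \<omega>)" for n \<omega>
  proof -
    have pos: "0 < balls n k \<omega>" "0 < balls n j \<omega>"
      using balls_ge_1[OF k, of n \<omega>] balls_ge_1[OF j, of n \<omega>] by auto
    have "m k * L n \<omega> = ln (balls n k \<omega>) - m k / m j * ln (balls n j \<omega>)"
      using m_pos[OF k] by (simp add: L_def right_diff_distrib)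
    then show ?thesis
      using pos by (simp add: exp_diff powr_def balls_def)
  qed
  show "\<exists>\<xi>\<in>borel_measurable M. (\<forall>\<omega>\<in>space M. \<xi> \<omega> \<in> {0<..}) \<and>
    (AE \<omega> in M. (\<lambda>n. real (urn_comp H0 X A n k \<omega>) / real (urn_comp H0 X A n j \<omega>) powr (m k / m j))
       \<longlonglongrightarrow> (\<xi> \<omega> :: real))"
  proof (intro bexI conjI)
    \<comment> \<open>Where the sequence diverges, \<open>lim\<close> is some unspecified real; the limit variable is still positive.\<close>
    show "(\<lambda>\<omega>. exp (m k * lim (\<lambda>n. L n \<omega>))) \<in> borel_measurable M"
      by measurable
    show "AE \<omega> in M. (\<lambda>n. real (urn_comp H0 X A n k \<omega>) / real (urn_comp H0 X A n j \<omega>) powr (m k / m j))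
       \<longlonglongrightarrow> exp (m k * lim (\<lambda>n. L n \<omega>))"
      using conv unfolding ratio
      by eventually_elim (intro tendsto_intros, simp add: convergent_LIMSEQ_iff)
  qed auto
qed

end
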